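(* Let $C\subset\mathbb{R}^3$ be the image of an embedded regular curve defined on a bounded closed interval, of length $l>0$ and with nowhere vanishing curvature, and let $\Gamma\subset\mathbb{R}^2$ be the image of an arc-length parametrized regular plane curve $\gamma:[-l/2,l/2]\to\mathbb{R}^2$ without self-intersections. Assume $\mathcal{P}_*(\Gamma,|C|)$ is non-empty, and let $N$ be the number of congruence classes of curved foldings in $\mathcal{P}_*(\Gamma,|C|)$. Then: (1) if $C$ has no symmetries and $\Gamma$ has no symmetries, then $N=4$; (2) otherwise $N\le 2$; (3) $N=1$ if and only if one of the following holds: (a) $C$ lies in a plane and has a non-trivial symmetry; (b) $C$ lies in a plane and $\Gamma$ has a symmetry; (c) $C$ does not lie in any plane, $C$ has a positive symmetry, and $\Gamma$ has a symmetry.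
   Context: Orientation: $C$ carries an orientation; $-C$ is $C$ with the opposite orientation and $|C|$ the unoriented curve. Let $J=[-l/2,l/2]$ and $\mathbf c:J\to\mathbb R^3$ an arc-length parametrization of $C$ inducing its orientation. For a regular parametrization $\mathbf c_f$ of $C$ we use its curvature $\kappa_f$, torsion $\tau_f$ and Frenet frame $(\mathbf e,\mathbf n,\mathbf b)$. Developable strips: a developable strip along $C$ is the germ along $C$ of a $C^\infty$ embedding $f(u,v)=f(u,0)+v\,\xi_f(u)$ defined on a neighbourhood of $J_0\times\{0\}$ in $J_0\times\mathbb R$ ($J_0$ a closed interval) such that $\mathbf c_f(u):=f(u,0)$ parametrizes $C$, $\xi_f$ is a unit vector field, and the Gaussian curvature of $f$ vanishes identically. Write $\xi_f=\cos\beta_f\,\mathbf e+\sin\beta_f(\cos\alpha_f\,\mathbf n+\sin\alpha_f\,\mathbf b)$ with the Frenet frame of $\mathbf c_f$. $\mathcal D(C)$ is the set of developable strips along $C$ such that $\mathbf c_f$ induces the orientation of $C$ and $0<|\cos\alpha_f|<1$; one normalizes $0<|\alpha_f|<\pi/2$ (first angular function) and $0<\beta_f<\pi$ (second angular function); vanishing Gaussian curvature is equivalent to $\cot\beta_f=(\alpha_f'+|\mathbf c_f'|\tau_f)/(|\mathbf c_f'|\kappa_f\sin\alpha_f)$. The geodesic curvature function is $\mu_f:=\kappa_f\cos\alpha_f>0$. $f$ is admissible if $\mu_f(u)<\min_w\kappa_f(w)$ for all $u$; $\mathcal D_*(C)$ is the set of admissible strips, and $\mathcal D_*(|C|):=\mathcal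 D_*(C)\cup\mathcal D_*(-C)$. Normal forms: a normal form is a developable strip $F(s,v)$ defined near $J\times\{0\}$ such that $s\mapsto F(s,0)$ is an arc-length parametrization of $C$. A normal form is determined by this parametrization and its first angular function, and every smooth function with values in $(-\pi/2,\pi/2)\setminus\{0\}$ occurs. The dual $\check F$ of a normal form $F$ is the normal form with $\check F(s,0)=F(s,0)$ and first angular function $-\alpha_F$. Curved foldings: the origami map of a normal form $F$ is $\Phi_F(s,v)=F(s,v)$ for $v\ge 0$ and $\Phi_F(s,v)=\check F(s,v)$ for $v<0$. Two functions $\mu_1,\mu_2$ on $[-l/2,l/2]$ are equi-affine equivalent if $\mu_2(\sigma s+d)=\mu_1(s)$ for some $\sigma\in\{1,-1\}$, $d\in\mathbb R$. $\Gamma$ is a generator (crease pattern) of $F$ if the curvature function of $\gamma$ is equi-affine equivalent to $\mu_F$. $\mathcal P_*(\Gamma,|C|)$ is the set of germs along $C$ of the images $\Phi_F(J\times(-\epsilon,\epsilon))$, $F$ ranging over normal forms in $\mathcal D_*(|C|)$ having generator $\Gamma$. Two such germs are congruent if there exist an isometry $T$ of $\mathbb R^3$ and $\epsilon_0>0$ such that $T$ maps the first image onto the second for all $0<\epsilon<\epsilon_0$. Symmetry: a subset $A\subset\mathbb R^k$ ($k=2,3$) has a symmetry $T$ if $T(A)=A$ for an isometry $T$ of $\mathbb R^k$ other than the identity; the symmetry is non-trivial if $T(\mathbf x)\ne\mathbf x$ for some $\mathbf x\in A$, and positive (resp. negative) if $T$ preserves (resp. reverses) orientation of $\mathbb R^k$.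 *)

theory Defs
  imports "HOL-Analysis.Analysis" "HOL-Analysis.Cross3"
begin

primrec nderiv :: "nat \<Rightarrow> (real \<Rightarrow> 'a::real_normed_vector) \<Rightarrow> real set \<Rightarrow> real \<Rightarrow> 'a" where
  "nderiv 0 f S = f"
| "nderiv (Suc k) f S = (\<lambda>s. vector_derivative (nderiv k f S) (at s within S))"

definition smooth_on :: "real set \<Rightarrow> (real \<Rightarrow> 'a::real_normed_vector) \<Rightarrow> bool" where
  "smooth_on S f \<longleftrightarrow>
     (\<forall>k. \<forall>s\<in>S. (nderiv k f S has_vector_derivative nderiv (Suc k) f S s) (at s within S))"

definition Jint :: "real \<Rightarrow> real set" where
  "Jint l = {-l/2 .. l/2}"

definition arclen_param :: "real \<Rightarrow> (real \<Rightarrow> 'a::euclidean_space) \<Rightarrow> bool" where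
  "arclen_param l c \<longleftrightarrow> smooth_on (Jint l) c \<and> inj_on c (Jint l) \<and>
     (\<forall>s\<in>Jint l. norm (nderiv 1 c (Jint l) s) = 1)"

definition kappa :: "real \<Rightarrow> (real \<Rightarrow> real^3) \<Rightarrow> real \<Rightarrow> real" where
  "kappa l c s = norm (nderiv 2 c (Jint l) s)"

definition tau :: "real \<Rightarrow> (real \<Rightarrow> real^3) \<Rightarrow> real \<Rightarrow> real" where
  "tau l c s = (cross3 (nderiv 1 c (Jint l) s) (nderiv 2 c (Jint l) s) \<bullet> nderiv 3 c (Jint l) s)
                 / (kappa l c s)\<^sup>2"

definition frenet_e :: "real \<Rightarrow> (real \<Rightarrow> real^3) \<Rightarrow> real \<Rightarrow> real^3" where
  "frenet_e l c s = nderiv 1 c (Jint l) s"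

definition frenet_n :: "real \<Rightarrow> (real \<Rightarrow> real^3) \<Rightarrow> real \<Rightarrow> real^3" where
  "frenet_n l c s = (1 / kappa l c s) *\<^sub>R nderiv 2 c (Jint l) s"

definition frenet_b :: "real \<Rightarrow> (real \<Rightarrow> real^3) \<Rightarrow> real \<Rightarrow> real^3" where
  "frenet_b l c s = cross3 (frenet_e l c s) (frenet_n l c s)"

text \<open>Second angular function beta in (0,pi), determined by the first angular function alpha via
  the developability condition cot beta = (alpha' + tau) / (kappa sin alpha) (arc-length case).\<close>
definition beta_ang :: "real \<Rightarrow> (real \<Rightarrow> real^3) \<Rightarrow> (real \<Rightarrow> real) \<Rightarrow> real \<Rightarrow> real" where
  "beta_ang l c \<alpha> s =
     pi/2 - arctan ((nderiv 1 \<alpha> (Jint l) s + tau l c s) / (kappa l c s * sin (\<alpha> s)))"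

definition ruling :: "real \<Rightarrow> (real \<Rightarrow> real^3) \<Rightarrow> (real \<Rightarrow> real) \<Rightarrow> real \<Rightarrow> real^3" where
  "ruling l c \<alpha> s =
     cos (beta_ang l c \<alpha> s) *\<^sub>R frenet_e l c s
     + sin (beta_ang l c \<alpha> s) *\<^sub>R (cos (\<alpha> s) *\<^sub>R frenet_n l c s + sin (\<alpha> s) *\<^sub>R frenet_b l c s)"

definition normal_form :: "real \<Rightarrow> (real \<Rightarrow> real^3) \<Rightarrow> (real \<Rightarrow> real) \<Rightarrow> real \<Rightarrow> real \<Rightarrow> real^3" where
  "normal_form l c \<alpha> s v = c s + v *\<^sub>R ruling l c \<alpha> s"

text \<open>Image of J x (-eps,eps) under the origami map: F for v >= 0, the dual (first angular
  function -alpha) for v < 0.\<close>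
definition origami_image :: "real \<Rightarrow> (real \<Rightarrow> real^3) \<Rightarrow> (real \<Rightarrow> real) \<Rightarrow> real \<Rightarrow> (real^3) set" where
  "origami_image l c \<alpha> \<epsilon> =
     {normal_form l c \<alpha> s v | s v. s \<in> Jint l \<and> 0 \<le> v \<and> v < \<epsilon>}
     \<union> {normal_form l c (\<lambda>t. - \<alpha> t) s v | s v. s \<in> Jint l \<and> -\<epsilon> < v \<and> v < 0}"

text \<open>Normal forms in D_*(|C|): c an arc-length parametrization of C (either orientation),
  alpha smooth with values in (-pi/2,pi/2) minus 0, and admissibility mu_F < min kappa.\<close>
definition admissible_nf :: "real \<Rightarrow> (real^3) set \<Rightarrow> (real \<Rightarrow> real^3) \<Rightarrow> (real \<Rightarrow> real) \<Rightarrow> bool" where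
  "admissible_nf l C c \<alpha> \<longleftrightarrow>
     arclen_param l c \<and> c ` Jint l = C \<and> smooth_on (Jint l) \<alpha> \<and>
     (\<forall>s\<in>Jint l. 0 < \<bar>\<alpha> s\<bar> \<and> \<bar>\<alpha> s\<bar> < pi/2) \<and>
     (\<forall>s\<in>Jint l. kappa l c s * cos (\<alpha> s) < (INF w\<in>Jint l. kappa l c w))"

text \<open>Geodesic curvature function mu_F = kappa cos alpha.\<close>
definition mu_nf :: "real \<Rightarrow> (real \<Rightarrow> real^3) \<Rightarrow> (real \<Rightarrow> real) \<Rightarrow> real \<Rightarrow> real" where
  "mu_nf l c \<alpha> s = kappa l c s * cos (\<alpha> s)"

definition plane_curv :: "real \<Rightarrow> (real \<Rightarrow> real^2) \<Rightarrow> real \<Rightarrow> real" where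
  "plane_curv l \<gamma> s = norm (nderiv 2 \<gamma> (Jint l) s)"

definition equi_affine_equiv :: "real \<Rightarrow> (real \<Rightarrow> real) \<Rightarrow> (real \<Rightarrow> real) \<Rightarrow> bool" where
  "equi_affine_equiv l \<mu>1 \<mu>2 \<longleftrightarrow>
     (\<exists>\<sigma> d. (\<sigma> = 1 \<or> \<sigma> = -1) \<and>
        (\<forall>s\<in>Jint l. \<sigma> * s + d \<in> Jint l \<and> \<mu>2 (\<sigma> * s + d) = \<mu>1 s))"

definition is_generator :: "real \<Rightarrow> (real \<Rightarrow> real^2) \<Rightarrow> (real \<Rightarrow> real^3) \<Rightarrow> (real \<Rightarrow> real) \<Rightarrow> bool" where
  "is_generator l \<gamma> c \<alpha> \<longleftrightarrow> equi_affine_equiv l (plane_curv l \<gamma>) (mu_nf l c \<alpha>)"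

text \<open>Elements of P_*(Gamma,|C|), represented by the data (c, alpha) of the normal form.\<close>
definition P_star :: "real \<Rightarrow> (real \<Rightarrow> real^2) \<Rightarrow> (real^3) set
                       \<Rightarrow> ((real \<Rightarrow> real^3) \<times> (real \<Rightarrow> real)) set" where
  "P_star l \<gamma> C = {(c, \<alpha>). admissible_nf l C c \<alpha> \<and> is_generator l \<gamma> c \<alpha>}"

definition isometry :: "('a::metric_space \<Rightarrow> 'a) \<Rightarrow> bool" where
  "isometry T \<longleftrightarrow> (\<forall>x y. dist (T x) (T y) = dist x y)"

definition germ_congruent :: "real \<Rightarrow> ((real \<Rightarrow> real^3) \<times> (real \<Rightarrow> real))
                              \<Rightarrow> ((real \<Rightarrow> real^3) \<times> (real \<Rightarrow> real)) \<Rightarrow> bool" where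
  "germ_congruent l F G \<longleftrightarrow>
     (\<exists>T \<epsilon>0. isometry T \<and> \<epsilon>0 > 0 \<and>
        (\<forall>\<epsilon>. 0 < \<epsilon> \<and> \<epsilon> < \<epsilon>0 \<longrightarrow>
           T ` origami_image l (fst F) (snd F) \<epsilon> = origami_image l (fst G) (snd G) \<epsilon>))"

definition congr_classes :: "real \<Rightarrow> (real \<Rightarrow> real^2) \<Rightarrow> (real^3) set
                       \<Rightarrow> ((real \<Rightarrow> real^3) \<times> (real \<Rightarrow> real)) set set" where
  "congr_classes l \<gamma> C = P_star l \<gamma> C //
     {(F, G). F \<in> P_star l \<gamma> C \<and> G \<in> P_star l \<gamma> C \<and> germ_congruent l F G}"

definition has_symmetry :: "('a::metric_space) set \<Rightarrow> bool" where
  "has_symmetry A \<longleftrightarrow> (\<exists>T. isometry T \<and> T \<noteq> id \<and> T ` A = A)"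

definition has_nontrivial_symmetry :: "('a::metric_space) set \<Rightarrow> bool" where
  "has_nontrivial_symmetry A \<longleftrightarrow> (\<exists>T. isometry T \<and> T \<noteq> id \<and> T ` A = A \<and> (\<exists>x\<in>A. T x \<noteq> x))"

definition orientation_preserving :: "(real^'n \<Rightarrow> real^'n) \<Rightarrow> bool" where
  "orientation_preserving T \<longleftrightarrow>
     (\<exists>Q b. orthogonal_matrix Q \<and> det Q > 0 \<and> (\<forall>x. T x = Q *v x + b))"

definition has_positive_symmetry :: "(real^'n) set \<Rightarrow> bool" where
  "has_positive_symmetry A \<longleftrightarrow>
     (\<exists>T. isometry T \<and> T \<noteq> id \<and> T ` A = A \<and> orientation_preserving T)"

definition lies_in_plane :: "(real^3) set \<Rightarrow> bool" where
  "lies_in_plane A \<longleftrightarrow> (\<exists>n d. n \<noteq> 0 \<and> (\<forall>x\<in>A. n \<bullet> x = d))"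

end

theory Submission
  imports Defs
begin

text \<open>
  The curve \<open>C\<close> has only two arc-length parametrizations, \<open>c\<close> and its reversal, and reversing \<open>c\<close> while
  replacing \<open>\<alpha>(s)\<close> by \<open>-\<alpha>(-s)\<close> does not change the curved folding. As \<open>\<kappa> cos \<alpha>\<close> must be the curvature
  \<open>m\<close> of the crease pattern or its reversal, every folding is given by \<open>c\<close> and one of the four angles
  \<open>\<plusminus>a0\<close>, \<open>\<plusminus>a1\<close> with \<open>cos a0(s) = m(s)/\<kappa>(s)\<close> and \<open>cos a1(s) = m(-s)/\<kappa>(s)\<close>.

  The germ of a folding determines \<open>C\<close>, as the intersection of the images, and the angle, through the
  tangent half-planes along \<open>C\<close>. Hence a congruence is a symmetry \<open>T\<close> of \<open>C\<close>, with linear part of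
  determinant \<open>\<delta> = \<plusminus>1\<close>; it turns \<open>\<alpha>(s)\<close> into \<open>\<delta> \<alpha>(s)\<close> if it fixes \<open>C\<close> pointwise and into \<open>-\<delta> \<alpha>(-s)\<close> if
  it reverses \<open>C\<close>. A symmetry other than the identity fixing \<open>C\<close> pointwise is the reflection in a plane
  containing \<open>C\<close>; reversing symmetries force \<open>\<kappa>\<close> to be even and therefore exchange \<open>|a0|\<close> and \<open>|a1|\<close>.
  Finally \<open>a0 = a1\<close> means that \<open>m\<close> is even, i.e. that \<open>\<Gamma>\<close> is symmetric. Counting the orbits of the
  four angles gives the theorem.
\<close>

subsection \<open>Smooth functions on an interval\<close>

text \<open>Keeps \<open>nderiv 1\<close> folded: the simplifier would otherwise turn it into
  \<open>nderiv (Suc 0)\<close> and then into a bare \<open>vector_derivative\<close>.\<close>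

declare nderiv.simps(2) [simp del] One_nat_def [simp del]

lemma uminus_Jint_iff [simp]: "- s \<in> Jint l \<longleftrightarrow> s \<in> Jint l"
  by (auto simp: Jint_def)

lemma uminus_image_Jint: "uminus ` Jint l = Jint l"
  by (auto simp: Jint_def)

lemma vector_derivative_Jint:
  assumes "l > 0" "s \<in> Jint l" "(f has_vector_derivative f') (at s within Jint l)"
  shows "vector_derivative f (at s within Jint l) = f'"
  using vector_derivative_within_cbox[of "-l/2" "l/2" s f f'] assms
  by (simp add: Jint_def)

lemma has_vector_derivative_unique_Jint:
  assumes "l > 0" "s \<in> Jint l" "(f has_vector_derivative f') (at s within Jint l)"
    "(f has_vector_derivative f'') (at s within Jint l)"
  shows "f' = f''"
  using assms vector_derivative_Jint by metis

text \<open>Derivatives within a nondegenerate interval are unique, so by induction an explicit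
  chain of derivatives starting at \<open>f\<close> must be the chain of its \<open>nderiv\<close>.
  The later formulas for iterated derivatives arise by exhibiting such a chain.\<close>

lemma nderiv_eqI:
  assumes l: "l > 0" and g0: "\<And>s. s \<in> Jint l \<Longrightarrow> f s = g 0 s"
    and g: "\<And>k s. s \<in> Jint l \<Longrightarrow> (g k has_vector_derivative g (Suc k) s) (at s within Jint l)"
  shows "s \<in> Jint l \<Longrightarrow> nderiv k f (Jint l) s = g k s" and "smooth_on (Jint l) f"
proof -
  have eq: "\<forall>s\<in>Jint l. nderiv k f (Jint l) s = g k s" for k
  proof (induction k)
    case 0
    then show ?case using g0 by simp
  next
    case (Suc k)
    show ?case
    proof
      fix s assume s: "s \<in> Jint l"
      have "(nderiv k f (Jint l) has_vector_derivative g (Suc k) s) (at s within Jint l)"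
        using has_vector_derivative_transform[OF s _ g[OF s]] Suc by blast
      then show "nderiv (Suc k) f (Jint l) s = g (Suc k) s"
        using vector_derivative_Jint[OF l s] by (simp add: nderiv.simps(2))
    qed
  qed
  then show "s \<in> Jint l \<Longrightarrow> nderiv k f (Jint l) s = g k s" by blast
  show "smooth_on (Jint l) f"
    unfolding smooth_on_def
  proof (intro allI ballI)
    fix k s assume s: "s \<in> Jint l"
    show "(nderiv k f (Jint l) has_vector_derivative nderiv (Suc k) f (Jint l) s) (at s within Jint l)"
      using has_vector_derivative_transform[OF s _ g[OF s]] eq s by metis
  qed
qed

lemma smooth_onD:
  "smooth_on S f \<Longrightarrow> s \<in> S \<Longrightarrow>
    (nderiv k f S has_vector_derivative nderiv (Suc k) f S s) (at s within S)"
  by (simp add: smooth_on_def)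

lemma smooth_onD_0:
  "smooth_on S f \<Longrightarrow> s \<in> S \<Longrightarrow> (f has_vector_derivative nderiv 1 f S s) (at s within S)"
  using smooth_onD[of S f s 0] by (simp add: One_nat_def)

lemma smooth_onD_1:
  "smooth_on S f \<Longrightarrow> s \<in> S \<Longrightarrow> (nderiv 1 f S has_vector_derivative nderiv 2 f S s) (at s within S)"
  using smooth_onD[of S f s 1] by (simp add: numeral_2_eq_2 One_nat_def)

lemma smooth_on_continuous_nderiv: "smooth_on S f \<Longrightarrow> continuous_on S (nderiv k f S)"
  by (meson smooth_onD continuous_on_eq_continuous_within has_vector_derivative_continuous)

lemma smooth_on_continuous: "smooth_on S f \<Longrightarrow> continuous_on S f"
  using smooth_on_continuous_nderiv[of S f 0] by simp

lemma smooth_on_cong: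
  assumes "l > 0" "smooth_on (Jint l) f" "\<And>s. s \<in> Jint l \<Longrightarrow> g s = f s"
  shows "s \<in> Jint l \<Longrightarrow> nderiv k g (Jint l) s = nderiv k f (Jint l) s" "smooth_on (Jint l) g"
  using nderiv_eqI[where f=g and g="\<lambda>k. nderiv k f (Jint l)", OF assms(1) _ smooth_onD[OF assms(2)]]
    assms(3) by simp_all

lemma smooth_on_reverse:
  assumes l: "l > 0" and f: "smooth_on (Jint l) f"
  shows "s \<in> Jint l \<Longrightarrow> nderiv k (\<lambda>s. f (- s)) (Jint l) s = (-1) ^ k *\<^sub>R nderiv k f (Jint l) (- s)"
    and "smooth_on (Jint l) (\<lambda>s. f (- s))"
proof -
  let ?g = "\<lambda>k s. (-1) ^ k *\<^sub>R nderiv k f (Jint l) (- s)"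
  have g: "(?g k has_vector_derivative ?g (Suc k) s) (at s within Jint l)" if s: "s \<in> Jint l" for k s
  proof -
    have "(nderiv k f (Jint l) \<circ> uminus has_vector_derivative (-1) *\<^sub>R nderiv (Suc k) f (Jint l) (- s))
        (at s within Jint l)"
      by (rule vector_diff_chain_within)
         (auto intro!: derivative_eq_intros smooth_onD[OF f] simp: s uminus_image_Jint)
    from has_vector_derivative_scaleR[OF DERIV_const this, of "(-1) ^ k"]
    show ?thesis by (simp add: o_def)
  qed
  show "s \<in> Jint l \<Longrightarrow> nderiv k (\<lambda>s. f (- s)) (Jint l) s = (-1) ^ k *\<^sub>R nderiv k f (Jint l) (- s)"
    and "smooth_on (Jint l) (\<lambda>s. f (- s))"
    using nderiv_eqI[where f="\<lambda>s. f (- s)" and g="?g", OF l _ g] by simp_all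
qed

lemma smooth_on_affine:
  assumes l: "l > 0" and f: "smooth_on (Jint l) f" and L: "bounded_linear L"
  shows "s \<in> Jint l \<Longrightarrow> k > 0 \<Longrightarrow> nderiv k (\<lambda>s. L (f s) + b) (Jint l) s = L (nderiv k f (Jint l) s)"
    and "smooth_on (Jint l) (\<lambda>s. L (f s) + b)"
proof -
  \<comment> \<open>The translation is present at order zero only; every differentiation removes
    it.\<close>
  let ?g = "\<lambda>k s. L (nderiv k f (Jint l) s) + (if k = 0 then b else 0)"
  have g: "(?g k has_vector_derivative ?g (Suc k) s) (at s within Jint l)" if s: "s \<in> Jint l" for k s
    using has_vector_derivative_add[OF bounded_linear.has_vector_derivative[OF L smooth_onD[OF f s]]
        has_vector_derivative_const, of k "if k = 0 then b else 0"] by simp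
  show "s \<in> Jint l \<Longrightarrow> k > 0 \<Longrightarrow> nderiv k (\<lambda>s. L (f s) + b) (Jint l) s = L (nderiv k f (Jint l) s)"
    and "smooth_on (Jint l) (\<lambda>s. L (f s) + b)"
    using nderiv_eqI[where f="\<lambda>s. L (f s) + b" and g="?g", OF l _ g] by simp_all
qed

lemma smooth_on_scaleR:
  assumes l: "l > 0" and f: "smooth_on (Jint l) f"
  shows "s \<in> Jint l \<Longrightarrow> nderiv k (\<lambda>s. r *\<^sub>R f s) (Jint l) s = r *\<^sub>R nderiv k f (Jint l) s"
    and "smooth_on (Jint l) (\<lambda>s. r *\<^sub>R f s)"
  using smooth_on_affine[where b=0, OF l f bounded_linear_scaleR_right[of r]]
  by (cases "k = 0"; simp)+

lemma smooth_on_minus: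
  assumes l: "l > 0" and f: "smooth_on (Jint l) f"
  shows "s \<in> Jint l \<Longrightarrow> nderiv k (\<lambda>s. - f s) (Jint l) s = - nderiv k f (Jint l) s"
    and "smooth_on (Jint l) (\<lambda>s. - f s)"
  using smooth_on_scaleR[OF l f, where r="-1"] by simp_all

text \<open>The derivative is existentially quantified instead of being given by
  \<open>vector_derivative\<close>, so closure under products, inverses and roots can be shown
  without formulas for iterated derivatives. Order zero demands nothing, not even
  continuity.\<close>

primrec Ck_on :: "nat \<Rightarrow> real set \<Rightarrow> (real \<Rightarrow> 'a::real_normed_vector) \<Rightarrow> bool" where
  "Ck_on 0 S f \<longleftrightarrow> True"
| "Ck_on (Suc k) S f \<longleftrightarrow>
     (\<exists>f'. (\<forall>s\<in>S. (f has_vector_derivative f' s) (at s within S)) \<and> Ck_on k S f')"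

lemma Ck_on_cong:
  assumes "Ck_on k S f" "\<And>s. s \<in> S \<Longrightarrow> g s = f s"
  shows "Ck_on k S g"
  using assms by (cases k) (auto intro: has_vector_derivative_transform)

lemma Ck_on_SucI:
  assumes "\<And>s. s \<in> S \<Longrightarrow> (f has_vector_derivative f' s) (at s within S)" "Ck_on k S f'"
  shows "Ck_on (Suc k) S f"
  using assms by auto

lemma Ck_on_SucE:
  assumes "Ck_on (Suc k) S f"
  obtains f' where "\<And>s. s \<in> S \<Longrightarrow> (f has_vector_derivative f' s) (at s within S)" "Ck_on k S f'"
  using assms by auto

lemma Ck_on_SucD: "Ck_on (Suc k) S f \<Longrightarrow> Ck_on k S f"
proof (induction k arbitrary: f)
  case (Suc k)
  from Suc.prems show ?case
    by (rule Ck_on_SucE) (rule Ck_on_SucI, assumption, rule Suc.IH)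
qed simp

lemma smooth_on_iff_Ck_on:
  assumes l: "l > 0"
  shows "smooth_on (Jint l) f \<longleftrightarrow> (\<forall>k. Ck_on k (Jint l) f)"
proof
  assume f: "smooth_on (Jint l) f"
  have "Ck_on k (Jint l) (nderiv j f (Jint l))" for k j
    by (induction k arbitrary: j) (use smooth_onD[OF f] in auto)
  from this[of _ 0] show "\<forall>k. Ck_on k (Jint l) f" by simp
next
  assume f: "\<forall>k. Ck_on k (Jint l) f"
  \<comment> \<open>Passing from \<open>j\<close> to \<open>Suc j\<close> costs one order, so the
    induction carries all orders at once. The witness for the derivative may depend on the order,
    but by uniqueness it agrees on the interval with \<open>nderiv (Suc j)\<close>.\<close>
  have *: "\<forall>k. Ck_on k (Jint l) (nderiv j f (Jint l))" for j
  proof (induction j)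
    case (Suc j)
    show ?case
    proof
      fix k
      obtain f' where f': "\<forall>s\<in>Jint l. (nderiv j f (Jint l) has_vector_derivative f' s) (at s within Jint l)"
        "Ck_on k (Jint l) f'"
        using Suc Ck_on.simps(2) by blast
      show "Ck_on k (Jint l) (nderiv (Suc j) f (Jint l))"
        using f' vector_derivative_Jint[OF l] by (auto intro!: Ck_on_cong[OF f'(2)] simp: nderiv.simps(2))
    qed
  qed (use f in simp)
  show "smooth_on (Jint l) f"
    unfolding smooth_on_def
  proof (intro allI ballI)
    fix j s assume s: "s \<in> Jint l"
    obtain f' where "\<forall>s\<in>Jint l. (nderiv j f (Jint l) has_vector_derivative f' s) (at s within Jint l)"
      using *[of j] Ck_on.simps(2) by blast
    then show "(nderiv j f (Jint l) has_vector_derivative nderiv (Suc j) f (Jint l) s) (at s within Jint l)"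
      using vector_derivative_Jint[OF l s] s by (metis nderiv.simps(2))
  qed
qed

lemma Ck_on_const: "Ck_on k S (\<lambda>_. a)"
  by (induction k arbitrary: a) (auto intro!: exI[of _ "\<lambda>_. 0"])

lemma Ck_on_add: "Ck_on k S f \<Longrightarrow> Ck_on k S g \<Longrightarrow> Ck_on k S (\<lambda>s. f s + g s)"
proof (induction k arbitrary: f g)
  case (Suc k)
  obtain f' where "\<And>s. s \<in> S \<Longrightarrow> (f has_vector_derivative f' s) (at s within S)" "Ck_on k S f'"
    using Ck_on_SucE[OF Suc.prems(1)] by blast
  moreover obtain g' where "\<And>s. s \<in> S \<Longrightarrow> (g has_vector_derivative g' s) (at s within S)" "Ck_on k S g'"
    using Ck_on_SucE[OF Suc.prems(2)] by blast
  ultimately show ?case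
    by (intro Ck_on_SucI[of S _ "\<lambda>s. f' s + g' s"] has_vector_derivative_add Suc.IH)
qed simp

lemma Ck_on_bilinear:
  assumes p: "bounded_bilinear p"
  shows "Ck_on k S f \<Longrightarrow> Ck_on k S g \<Longrightarrow> Ck_on k S (\<lambda>s. p (f s) (g s))"
proof (induction k arbitrary: f g)
  case (Suc k)
  obtain f' where f': "\<forall>s\<in>S. (f has_vector_derivative f' s) (at s within S)" "Ck_on k S f'"
    using Suc.prems by auto
  obtain g' where g': "\<forall>s\<in>S. (g has_vector_derivative g' s) (at s within S)" "Ck_on k S g'"
    using Suc.prems by auto
  have "Ck_on k S (\<lambda>s. p (f s) (g' s) + p (f' s) (g s))"
    by (intro Ck_on_add Suc.IH f' g' Ck_on_SucD[OF Suc.prems(1)] Ck_on_SucD[OF Suc.prems(2)])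
  then show ?case
    using bounded_bilinear.has_vector_derivative[OF p] f' g'
    by (auto intro!: exI[of _ "\<lambda>s. p (f s) (g' s) + p (f' s) (g s)"])
qed simp

lemmas Ck_on_mult = Ck_on_bilinear[OF bounded_bilinear_mult]

text \<open>The derivative is a product of the derivative of \<open>f\<close> with copies of
  \<open>inverse (f s)\<close> itself, so the induction hypothesis one order lower closes the step.
  The square root below is handled in the same way.\<close>

lemma Ck_on_inverse:
  fixes f :: "real \<Rightarrow> real"
  assumes "\<And>s. s \<in> S \<Longrightarrow> f s \<noteq> 0"
  shows "Ck_on k S f \<Longrightarrow> Ck_on k S (\<lambda>s. inverse (f s))"
proof (induction k)
  case (Suc k)
  obtain f' where f': "\<forall>s\<in>S. (f has_vector_derivative f' s) (at s within S)" "Ck_on k S f'"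
    using Suc.prems by auto
  have i: "Ck_on k S (\<lambda>s. inverse (f s))"
    using Suc Ck_on_SucD by blast
  have "Ck_on k S (\<lambda>s. (-1) * (f' s * (inverse (f s) * inverse (f s))))"
    by (intro Ck_on_mult Ck_on_const f' i)
  moreover have "((\<lambda>s. inverse (f s)) has_vector_derivative (-1) * (f' s * (inverse (f s) * inverse (f s))))
      (at s within S)" if "s \<in> S" for s
    using f' assms that
    by (auto simp: has_real_derivative_iff_has_vector_derivative[symmetric] intro!: derivative_eq_intros)
  ultimately show ?case by (rule Ck_on_SucI[rotated])
qed simp

lemma Ck_on_sqrt:
  assumes "\<And>s. s \<in> S \<Longrightarrow> f s > 0"
  shows "Ck_on k S f \<Longrightarrow> Ck_on k S (\<lambda>s. sqrt (f s))"
proof (induction k)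
  case (Suc k)
  obtain f' where f': "\<forall>s\<in>S. (f has_vector_derivative f' s) (at s within S)" "Ck_on k S f'"
    using Suc.prems by auto
  have i: "Ck_on k S (\<lambda>s. sqrt (f s))"
    using Suc Ck_on_SucD by blast
  have "Ck_on k S (\<lambda>s. (1/2) * (f' s * inverse (sqrt (f s))))"
    by (intro Ck_on_mult Ck_on_const Ck_on_inverse f' i) (use assms in force)
  moreover have "((\<lambda>s. sqrt (f s)) has_vector_derivative (1/2) * (f' s * inverse (sqrt (f s))))
      (at s within S)" if "s \<in> S" for s
    using f' assms[OF that] that
    by (auto simp: has_real_derivative_iff_has_vector_derivative[symmetric] field_simps intro!: derivative_eq_intros)
  ultimately show ?case by (rule Ck_on_SucI[rotated])
qed simp

text \<open>One differentiation leaves arccos behind: the derivative is built from \<open>f\<close>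
  by products, a root and an inverse, so the preceding closure rules suffice without
  induction.\<close>

lemma Ck_on_arccos:
  assumes "\<And>s. s \<in> S \<Longrightarrow> \<bar>f s\<bar> < 1" and f: "Ck_on k S f"
  shows "Ck_on k S (\<lambda>s. arccos (f s))"
proof (cases k)
  case (Suc j)
  obtain f' where f': "\<forall>s\<in>S. (f has_vector_derivative f' s) (at s within S)" "Ck_on j S f'"
    using f Suc by auto
  \<comment> \<open>The radicand below is written as a sum with a factor -1, so that the rules for
    sums, products and constants apply to it literally.\<close>
  have fj: "Ck_on j S f" using f Suc Ck_on_SucD by blast
  have sq: "1 + (-1) * (f s * f s) > 0" if "s \<in> S" for s
    using assms(1)[OF that] abs_square_less_1[of "f s"] by (simp add: power2_eq_square)
  have "Ck_on j S (\<lambda>s. (-1) * (f' s * inverse (sqrt (1 + (-1) * (f s * f s)))))"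
    by (intro Ck_on_mult Ck_on_const Ck_on_inverse Ck_on_sqrt Ck_on_add f' fj) (use sq in force)+
  moreover have "((\<lambda>s. arccos (f s)) has_vector_derivative (-1) * (f' s * inverse (sqrt (1 + (-1) * (f s * f s)))))
      (at s within S)" if s: "s \<in> S" for s
  proof -
    have "((\<lambda>s. arccos (f s)) has_real_derivative inverse (- sqrt (1 - (f s)\<^sup>2)) * f' s) (at s within S)"
      by (rule DERIV_chain2[OF DERIV_arccos])
         (use f' s assms(1)[OF s] in \<open>auto simp: has_real_derivative_iff_has_vector_derivative\<close>)
    then show ?thesis
      by (simp add: has_real_derivative_iff_has_vector_derivative power2_eq_square mult.commute)
  qed
  ultimately show ?thesis unfolding Suc by (rule Ck_on_SucI[rotated])
qed simp

lemma smooth_on_nderiv: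
  assumes l: "l > 0" and f: "smooth_on (Jint l) f"
  shows "smooth_on (Jint l) (nderiv k f (Jint l))"
  by (rule nderiv_eqI(2)[where g="\<lambda>j. nderiv (j + k) f (Jint l)", OF l])
     (use smooth_onD[OF f] in auto)

lemma smooth_on_norm:
  fixes f :: "real \<Rightarrow> 'a::real_inner"
  assumes l: "l > 0" and f: "smooth_on (Jint l) f" and nz: "\<And>s. s \<in> Jint l \<Longrightarrow> f s \<noteq> 0"
  shows "smooth_on (Jint l) (\<lambda>s. norm (f s))"
  unfolding smooth_on_iff_Ck_on[OF l] norm_eq_sqrt_inner
  using f[unfolded smooth_on_iff_Ck_on[OF l]] nz
  by (auto intro!: Ck_on_sqrt Ck_on_bilinear[OF bounded_bilinear_inner])

subsection \<open>Isometries and arc-length parametrizations\<close>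

lemma orthogonal_matrix_orthogonal_transformation:
  fixes Q :: "real^'n^'n"
  assumes "orthogonal_matrix Q"
  shows "orthogonal_transformation ((*v) Q)"
  using assms by (simp add: orthogonal_transformation_matrix)

lemma orthogonal_matrix_inner:
  fixes Q :: "real^'n^'n"
  assumes "orthogonal_matrix Q"
  shows "(Q *v x) \<bullet> (Q *v y) = x \<bullet> y"
  using orthogonal_matrix_orthogonal_transformation[OF assms] by (simp add: orthogonal_transformation_def)

lemma orthogonal_matrix_norm:
  fixes Q :: "real^'n^'n"
  assumes "orthogonal_matrix Q"
  shows "norm (Q *v x) = norm x"
  using orthogonal_transformation_norm[OF orthogonal_matrix_orthogonal_transformation[OF assms]] .

lemma isometry_affine:
  fixes T :: "real^'n \<Rightarrow> real^'n"
  assumes "isometry T"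
  obtains Q b where "orthogonal_matrix Q" "T = (\<lambda>x. Q *v x + b)"
proof -
  have "orthogonal_transformation (\<lambda>x. T x - T 0)"
    using assms unfolding orthogonal_transformation_isometry isometry_def by (simp add: dist_norm)
  then have "linear (\<lambda>x. T x - T 0)" "orthogonal_matrix (matrix (\<lambda>x. T x - T 0))"
    by (auto simp: orthogonal_transformation_matrix)
  then show thesis
    by (intro that[of "matrix (\<lambda>x. T x - T 0)" "T 0"]) (simp_all add: matrix_works)
qed

lemma affine_isometry:
  fixes Q :: "real^'n^'n"
  assumes "orthogonal_matrix Q"
  shows "isometry (\<lambda>x. Q *v x + b)"
  using orthogonal_matrix_norm[OF assms]
  by (simp add: isometry_def dist_norm matrix_vector_mult_diff_distrib[symmetric])

lemma isometry_comp: "isometry S \<Longrightarrow> isometry T \<Longrightarrow> isometry (S \<circ> T)"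
  by (simp add: isometry_def)

lemma isometry_id: "isometry id"
  by (simp add: isometry_def)

lemma isometry_inj: "isometry T \<Longrightarrow> inj T"
  unfolding isometry_def inj_def by (metis dist_eq_0_iff)

lemma isometry_bij:
  fixes T :: "real^'n \<Rightarrow> real^'n"
  assumes "isometry T"
  shows "bij T"
proof -
  obtain Q b where Q: "orthogonal_matrix Q" and T: "T = (\<lambda>x. Q *v x + b)"
    using isometry_affine[OF assms] .
  have "surj T"
  proof (rule surjI)
    show "T (transpose Q *v (x - b)) = x" for x
      using Q by (simp add: T matrix_vector_mul_assoc orthogonal_matrix_def del: transpose_matrix_vector)
  qed
  then show ?thesis using isometry_inj[OF assms] by (simp add: bij_def)
qed

lemma isometry_inv:
  fixes T :: "real^'n \<Rightarrow> real^'n"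
  assumes "isometry T"
  shows "isometry (inv T)"
  using assms isometry_bij[OF assms] unfolding isometry_def by (metis bij_inv_eq_iff)

text \<open>If \<open>T\<close> moves \<open>y\<close>, every fixed point is equidistant from
  \<open>y\<close> and \<open>T y\<close>, hence lies on their perpendicular bisector.\<close>

lemma isometry_fixing_hyperplane:
  fixes T :: "'a::real_inner \<Rightarrow> 'a"
  assumes "isometry T" "T \<noteq> id" "\<And>x. x \<in> A \<Longrightarrow> T x = x"
  obtains n d where "n \<noteq> 0" "\<And>x. x \<in> A \<Longrightarrow> n \<bullet> x = d"
proof -
  obtain y where y: "T y \<noteq> y" using assms(2) by (metis eq_id_iff)
  have "(T y - y) \<bullet> x = (T y \<bullet> T y - y \<bullet> y) / 2" if "x \<in> A" for x
  proof -
    have "norm (x - T y) = norm (x - y)"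
      using assms(1,3) that unfolding isometry_def dist_norm by metis
    then have "(x - T y) \<bullet> (x - T y) = (x - y) \<bullet> (x - y)"
      by (simp add: norm_eq)
    then show ?thesis by (simp add: algebra_simps inner_commute)
  qed
  with y show thesis by (intro that[of "T y - y" "(T y \<bullet> T y - y \<bullet> y) / 2"]) auto
qed

text \<open>Speed as a limit of chord lengths divided by parameter differences. In this form two
  parametrizations can be compared before their transition map is known to be
  differentiable.\<close>

lemma has_vector_derivative_norm_quotient:
  fixes f :: "real \<Rightarrow> 'a::real_normed_vector"
  assumes "(f has_vector_derivative f') (at s within S)"
  shows "((\<lambda>t. norm (f t - f s) / \<bar>t - s\<bar>) \<longlongrightarrow> norm f') (at s within S)"
proof (rule LIM_zero_cancel, rule Lim_null_comparison)
  show "((\<lambda>t. norm ((1 / norm (t - s)) *\<^sub>R (f t - (f s + (t - s) *\<^sub>R f')))) \<longlongrightarrow> 0) (at s within S)"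
    using assms unfolding has_vector_derivative_def has_derivative_within by (metis tendsto_norm_zero)
  have "norm (norm (f t - f s) / \<bar>t - s\<bar> - norm f')
      \<le> norm ((1 / norm (t - s)) *\<^sub>R (f t - (f s + (t - s) *\<^sub>R f')))" if "t \<noteq> s" for t
  proof -
    have "norm (f t - f s) / \<bar>t - s\<bar> - norm f' = (norm (f t - f s) - norm ((t - s) *\<^sub>R f')) / \<bar>t - s\<bar>"
      using that by (simp add: diff_divide_distrib)
    moreover have "\<bar>norm (f t - f s) - norm ((t - s) *\<^sub>R f')\<bar> \<le> norm (f t - (f s + (t - s) *\<^sub>R f'))"
      using norm_triangle_ineq3[of "f t - f s" "(t - s) *\<^sub>R f'"] by (simp add: algebra_simps)
    ultimately show ?thesis
      using that by (simp add: divide_right_mono)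
  qed
  then show "\<forall>\<^sub>F t in at s within S. norm (norm (f t - f s) / \<bar>t - s\<bar> - norm f')
      \<le> norm ((1 / norm (t - s)) *\<^sub>R (f t - (f s + (t - s) *\<^sub>R f')))"
    by (auto simp: eventually_at_filter)
qed

lemma continuous_nonzero_sign:
  fixes f :: "real \<Rightarrow> real"
  assumes "continuous_on (Jint l) f" "\<And>s. s \<in> Jint l \<Longrightarrow> f s \<noteq> 0"
  shows "(\<forall>s\<in>Jint l. f s > 0) \<or> (\<forall>s\<in>Jint l. f s < 0)"
proof (rule ccontr)
  assume "\<not> ?thesis"
  then obtain s t where st: "s \<in> Jint l" "f s < 0" "t \<in> Jint l" "f t > 0"
    using assms(2) by (metis linorder_neqE_linordered_idom)
  have "connected (f ` Jint l)"
    using assms(1) by (intro connected_continuous_image) (auto simp: Jint_def)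
  then have "0 \<in> f ` Jint l"
    using st by (meson connectedD_interval imageI less_imp_le)
  then show False using assms(2) by auto
qed

lemma zero_in_Jint: "l > 0 \<Longrightarrow> 0 \<in> Jint l"
  by (simp add: Jint_def)

lemma convex_Jint: "convex (Jint l)"
  by (simp add: Jint_def)

lemma compact_Jint: "compact (Jint l)"
  by (simp add: Jint_def)

lemma endpoint_in_Jint: "l > 0 \<Longrightarrow> l/2 \<in> Jint l"
  by (simp add: Jint_def)

lemma arclen_paramD:
  assumes "arclen_param l c"
  shows "smooth_on (Jint l) c" "inj_on c (Jint l)" "\<And>s. s \<in> Jint l \<Longrightarrow> norm (nderiv 1 c (Jint l) s) = 1"
  using assms by (auto simp: arclen_param_def)

text \<open>A continuous injection of an interval is monotone, so the absolute values can be removed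
  with one global sign. The map then has constant derivative 1 or -1, and the endpoints determine
  the remaining constant.\<close>

lemma unit_speed_bij_Jint:
  assumes l: "l > 0" and surj: "\<phi> ` Jint l = Jint l" and cont: "continuous_on (Jint l) \<phi>"
    and inj: "inj_on \<phi> (Jint l)"
    and lim: "\<And>s. s \<in> Jint l \<Longrightarrow> ((\<lambda>t. \<bar>\<phi> t - \<phi> s\<bar> / \<bar>t - s\<bar>) \<longlongrightarrow> 1) (at s within Jint l)"
  shows "(\<forall>s\<in>Jint l. \<phi> s = s) \<or> (\<forall>s\<in>Jint l. \<phi> s = - s)"
proof -
  have "is_interval (Jint l)" by (simp add: Jint_def)
  then have mono: "strict_mono_on (Jint l) \<phi> \<or> strict_antimono_on (Jint l) \<phi>"
    using injective_eq_monotone_map cont inj by blast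
  \<comment> \<open>The case \<open>s = t\<close> is included: division by zero makes both sides
    0.\<close>
  obtain \<sigma> :: real where \<sigma>: "\<sigma> = 1 \<or> \<sigma> = -1"
    and abs: "\<And>s t. s \<in> Jint l \<Longrightarrow> t \<in> Jint l \<Longrightarrow> \<bar>\<phi> t - \<phi> s\<bar> / \<bar>t - s\<bar> = \<sigma> * ((\<phi> t - \<phi> s) / (t - s))"
    using mono
  proof
    assume m: "strict_mono_on (Jint l) \<phi>"
    have "\<bar>\<phi> t - \<phi> s\<bar> / \<bar>t - s\<bar> = 1 * ((\<phi> t - \<phi> s) / (t - s))" if "s \<in> Jint l" "t \<in> Jint l" for s t
      using strict_mono_onD[OF m that] strict_mono_onD[OF m that(2,1)]
      by (cases s t rule: linorder_cases) (auto simp: minus_divide_divide[of "\<phi> s - \<phi> t", symmetric] abs_if)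
    then show thesis using that[of 1] by blast
  next
    assume m: "strict_antimono_on (Jint l) \<phi>"
    have "\<bar>\<phi> t - \<phi> s\<bar> / \<bar>t - s\<bar> = (-1) * ((\<phi> t - \<phi> s) / (t - s))" if "s \<in> Jint l" "t \<in> Jint l" for s t
      using monotone_onD[OF m that] monotone_onD[OF m that(2,1)]
      by (cases s t rule: linorder_cases) (auto simp: minus_divide_divide[of "\<phi> s - \<phi> t", symmetric] abs_if field_simps)
    then show thesis using that[of "-1"] by blast
  qed
  have "(\<phi> has_real_derivative \<sigma>) (at s within Jint l)" if s: "s \<in> Jint l" for s
  proof -
    have "((\<lambda>t. \<sigma> * (\<bar>\<phi> t - \<phi> s\<bar> / \<bar>t - s\<bar>)) \<longlongrightarrow> \<sigma> * 1) (at s within Jint l)"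
      by (intro tendsto_intros lim s)
    moreover have "\<forall>\<^sub>F t in at s within Jint l. \<sigma> * (\<bar>\<phi> t - \<phi> s\<bar> / \<bar>t - s\<bar>) = (\<phi> t - \<phi> s) / (t - s)"
    proof -
      have "\<sigma> * (\<bar>\<phi> t - \<phi> s\<bar> / \<bar>t - s\<bar>) = (\<phi> t - \<phi> s) / (t - s)" if "t \<in> Jint l" for t
        unfolding abs[OF s that] using \<sigma> by auto
      then show ?thesis by (auto simp: eventually_at_filter)
    qed
    ultimately have "((\<lambda>t. (\<phi> t - \<phi> s) / (t - s)) \<longlongrightarrow> \<sigma> * 1) (at s within Jint l)"
      by (rule Lim_transform_eventually)
    then show ?thesis
      by (simp add: has_field_derivative_iff)
  qed
  then have "((\<lambda>s. \<phi> s - \<sigma> * s) has_real_derivative 0) (at s within Jint l)" if "s \<in> Jint l" for s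
    using that by (auto intro!: derivative_eq_intros)
  from has_field_derivative_zero_constant[OF convex_Jint this]
  obtain k where k: "\<And>s. s \<in> Jint l \<Longrightarrow> \<phi> s - \<sigma> * s = k" by blast
  \<comment> \<open>The images of the two endpoints are \<open>l\<close> apart and both lie in an
    interval of length \<open>l\<close> centred at 0, so the shift \<open>k\<close> is 0.\<close>
  have "l/2 \<in> Jint l" "-(l/2) \<in> Jint l" using l by (auto simp: Jint_def)
  then have "\<phi> (l/2) \<in> Jint l" "\<phi> (-(l/2)) \<in> Jint l" "\<phi> (l/2) = \<sigma> * (l/2) + k" "\<phi> (-(l/2)) = \<sigma> * (-(l/2)) + k"
    using surj k[of "l/2"] k[of "-(l/2)"] by auto
  then have "k = 0" using \<sigma> by (auto simp: Jint_def)
  then show ?thesis using k \<sigma> by force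
qed

text \<open>The transition map, the inverse of \<open>c1\<close> after \<open>c2\<close>, is
  continuous by compactness. Both curves have unit speed, so the quotient of their chord ratios
  shows that the transition map changes distances at rate 1, and \<open>unit_speed_bij_Jint\<close>
  applies.\<close>

lemma arclen_param_unique:
  assumes l: "l > 0" and c1: "arclen_param l c1" and c2: "arclen_param l c2"
    and img: "c2 ` Jint l = c1 ` Jint l"
  shows "(\<forall>s\<in>Jint l. c2 s = c1 s) \<or> (\<forall>s\<in>Jint l. c2 s = c1 (- s))"
proof -
  note c1 = arclen_paramD[OF c1] and c2 = arclen_paramD[OF c2]
  define \<phi> where "\<phi> = the_inv_into (Jint l) c1 \<circ> c2"
  have \<phi>: "\<phi> s \<in> Jint l" "c1 (\<phi> s) = c2 s" if "s \<in> Jint l" for s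
    using that img the_inv_into_into[OF c1(2), of "c2 s" "Jint l"] f_the_inv_into_f[OF c1(2), of "c2 s"]
    by (auto simp: \<phi>_def)
  have cont: "continuous_on (Jint l) \<phi>"
    unfolding \<phi>_def using img smooth_on_continuous[OF c2(1)]
      continuous_on_inv_into[OF smooth_on_continuous[OF c1(1)] compact_Jint c1(2)]
    by (intro continuous_on_compose) auto
  have inj: "inj_on \<phi> (Jint l)"
    using c2(2) \<phi>(2) by (metis inj_on_def)
  have surj: "\<phi> ` Jint l = Jint l"
  proof
    show "Jint l \<subseteq> \<phi> ` Jint l"
    proof
      fix u assume u: "u \<in> Jint l"
      then obtain s where "s \<in> Jint l" "c2 s = c1 u" using img by (metis imageE imageI)
      then show "u \<in> \<phi> ` Jint l" using \<phi> c1(2) u by (metis imageI inj_onD)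
    qed
  qed (use \<phi> in auto)
  have "((\<lambda>t. \<bar>\<phi> t - \<phi> s\<bar> / \<bar>t - s\<bar>) \<longlongrightarrow> 1) (at s within Jint l)" if s: "s \<in> Jint l" for s
  proof -
    have 2: "((\<lambda>t. norm (c2 t - c2 s) / \<bar>t - s\<bar>) \<longlongrightarrow> 1) (at s within Jint l)"
      using has_vector_derivative_norm_quotient[OF smooth_onD_0[OF c2(1) s]] c2(3)[OF s] by simp
    have 1: "((\<lambda>t. norm (c1 t - c1 (\<phi> s)) / \<bar>t - \<phi> s\<bar>) \<longlongrightarrow> 1) (at (\<phi> s) within Jint l)"
      using has_vector_derivative_norm_quotient[OF smooth_onD_0[OF c1(1) \<phi>(1)[OF s]]] c1(3)[OF \<phi>(1)[OF s]] by simp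
    have "filterlim \<phi> (at (\<phi> s) within Jint l) (at s within Jint l)"
      using cont s \<phi>(1) inj
      by (auto simp: filterlim_at continuous_on_def eventually_at_filter inj_on_def intro!: eventuallyI)
    from filterlim_compose[OF 1 this] tendsto_divide[OF 2]
    have "((\<lambda>t. (norm (c2 t - c2 s) / \<bar>t - s\<bar>) / (norm (c1 (\<phi> t) - c1 (\<phi> s)) / \<bar>\<phi> t - \<phi> s\<bar>)) \<longlongrightarrow> 1) (at s within Jint l)"
      by force
    \<comment> \<open>Since \<open>c1 (\<phi> t) = c2 t\<close>, the two chords coincide and cancel;
      they are nonzero for \<open>t\<close> different from \<open>s\<close> because
      \<open>c2\<close> is injective.\<close>
    moreover have "\<forall>\<^sub>F t in at s within Jint l. (norm (c2 t - c2 s) / \<bar>t - s\<bar>) / (norm (c1 (\<phi> t) - c1 (\<phi> s)) / \<bar>\<phi> t - \<phi> s\<bar>)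
        = \<bar>\<phi> t - \<phi> s\<bar> / \<bar>t - s\<bar>"
      using s \<phi>(2) c2(2) by (auto simp: eventually_at_filter inj_on_def intro!: eventuallyI)
    ultimately show ?thesis by (rule Lim_transform_eventually)
  qed
  from unit_speed_bij_Jint[OF l surj cont inj this] show ?thesis
    using \<phi>(2) by metis
qed

lemma arclen_param_reverse:
  assumes l: "l > 0" and c: "arclen_param l c"
  shows "arclen_param l (\<lambda>s. c (- s))"
  unfolding arclen_param_def
proof (intro conjI ballI)
  note c = arclen_paramD[OF c]
  show "smooth_on (Jint l) (\<lambda>s. c (- s))" by (rule smooth_on_reverse(2)[OF l c(1)])
  show "inj_on (\<lambda>s. c (- s)) (Jint l)"
    by (intro inj_onI) (metis c(2) inj_onD neg_equal_iff_equal uminus_Jint_iff)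
  show "norm (nderiv 1 (\<lambda>s. c (- s)) (Jint l) s) = 1" if "s \<in> Jint l" for s
    using smooth_on_reverse(1)[OF l c(1) that, of 1] c(3)[of "- s"] that by simp
qed

lemma reverse_image_Jint: "(\<lambda>s. c (- s)) ` Jint l = c ` Jint l"
  using uminus_image_Jint[of l] by (metis image_image)

lemma arclen_param_affine:
  fixes c :: "real \<Rightarrow> real^'n"
  assumes l: "l > 0" and c: "arclen_param l c" and Q: "orthogonal_matrix Q"
  shows "arclen_param l (\<lambda>s. Q *v c s + b)"
  unfolding arclen_param_def
proof (intro conjI ballI)
  note c = arclen_paramD[OF c]
  have L: "bounded_linear ((*v) Q)" by simp
  show "smooth_on (Jint l) (\<lambda>s. Q *v c s + b)" by (rule smooth_on_affine(2)[OF l c(1) L])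
  show "inj_on (\<lambda>s. Q *v c s + b) (Jint l)"
    using c(2) orthogonal_transformation_inj[OF orthogonal_matrix_orthogonal_transformation[OF Q]]
    by (auto simp: inj_on_def)
  show "norm (nderiv 1 (\<lambda>s. Q *v c s + b) (Jint l) s) = 1" if "s \<in> Jint l" for s
    using smooth_on_affine(1)[OF l c(1) L that, of 1] c(3)[OF that] orthogonal_matrix_norm[OF Q] by simp
qed

text \<open>A symmetry carries \<open>c\<close> to another arc-length parametrization of the same
  image, to which the uniqueness result applies.\<close>

lemma symmetry_param_cases:
  fixes c :: "real \<Rightarrow> real^'n"
  assumes l: "l > 0" and c: "arclen_param l c" and Q: "orthogonal_matrix Q"
    and img: "(\<lambda>x. Q *v x + b) ` c ` Jint l = c ` Jint l"
  shows "(\<forall>s\<in>Jint l. Q *v c s + b = c s) \<or> (\<forall>s\<in>Jint l. Q *v c s + b = c (- s))"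
  using arclen_param_unique[OF l c arclen_param_affine[OF l c Q, of b]] img by (simp add: image_image)

lemma arclen_param_orthogonal:
  assumes l: "l > 0" and c: "arclen_param l c" and s: "s \<in> Jint l"
  shows "nderiv 1 c (Jint l) s \<bullet> nderiv 2 c (Jint l) s = 0"
proof -
  note c = arclen_paramD[OF c]
  let ?e = "nderiv 1 c (Jint l)" and ?a = "nderiv 2 c (Jint l)"
  have "((\<lambda>s. ?e s \<bullet> ?e s) has_vector_derivative (?e s \<bullet> ?a s + ?a s \<bullet> ?e s)) (at s within Jint l)"
    by (intro bounded_bilinear.has_vector_derivative[OF bounded_bilinear_inner] smooth_onD_1 c s)
  moreover have "((\<lambda>s. ?e s \<bullet> ?e s) has_vector_derivative 0) (at s within Jint l)"
    by (rule has_vector_derivative_transform[OF s _ has_vector_derivative_const[of 1]])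
       (simp add: c(3) dot_square_norm)
  ultimately show ?thesis
    using has_vector_derivative_unique_Jint[OF l s] by (fastforce simp: inner_commute)
qed

subsection \<open>Plane curves with even curvature\<close>

lemma has_vector_derivative_reverse:
  assumes "(f has_vector_derivative f') (at (- s) within Jint l)"
  shows "((\<lambda>s. f (- s)) has_vector_derivative - f') (at s within Jint l)"
proof -
  have "(f \<circ> uminus has_vector_derivative (-1) *\<^sub>R f') (at s within Jint l)"
    by (rule vector_diff_chain_within)
       (auto intro!: derivative_eq_intros assms simp: uminus_image_Jint)
  then show ?thesis by (simp add: o_def)
qed

lemma has_vector_derivative_zero_Jint:
  fixes f :: "real \<Rightarrow> 'a::real_normed_vector"
  assumes "\<And>s. s \<in> Jint l \<Longrightarrow> (f has_vector_derivative 0) (at s within Jint l)"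
  shows "\<exists>a. \<forall>s\<in>Jint l. f s = a"
  by (rule has_derivative_zero_constant[OF convex_Jint])
     (use assms in \<open>simp add: has_vector_derivative_def\<close>)

text \<open>Since \<open>\<gamma>'' = k rot90 \<gamma>'\<close> and the reflection along \<open>\<gamma>'(0)\<close> anticommutes with \<open>rot90\<close>, for even \<open>k\<close> the
  reflected and the reversed tangent solve the same linear equation with the same initial value.\<close>

definition rot90 :: "real^2 \<Rightarrow> real^2" where
  "rot90 x = vector [- x $ 2, x $ 1]"

lemma bounded_linear_rot90: "bounded_linear rot90"
  by (auto simp: rot90_def linear_iff vec_eq_iff forall_2 intro!: linear_conv_bounded_linear[THEN iffD1])

lemma rot90_inner_self: "x \<bullet> rot90 x = 0"
  by (simp add: rot90_def inner_vec_def sum_2)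

lemma perp_unit_eq_rot90:
  assumes "norm e = 1" "e \<bullet> a = 0"
  shows "a = (a \<bullet> rot90 e) *\<^sub>R rot90 e"
proof -
  have "e $ 1 * e $ 1 + e $ 2 * e $ 2 = 1" "e $ 1 * a $ 1 + e $ 2 * a $ 2 = 0"
    using assms by (simp_all add: norm_eq_1 inner_vec_def sum_2)
  then have "a $ 1 = (a $ 1 * e $ 2 - a $ 2 * e $ 1) * e $ 2" "a $ 2 = (a $ 2 * e $ 1 - a $ 1 * e $ 2) * e $ 1"
    by algebra+
  then show ?thesis
    by (simp add: rot90_def vec_eq_iff forall_2 inner_vec_def sum_2 algebra_simps)
qed

lemma norm_rot90: "norm (rot90 x) = norm x"
  by (simp add: rot90_def norm_eq inner_vec_def sum_2)

definition reflect_dir :: "'a::real_inner \<Rightarrow> 'a \<Rightarrow> 'a" where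
  "reflect_dir e x = x - (2 * (e \<bullet> x)) *\<^sub>R e"

lemma bounded_linear_reflect_dir: "bounded_linear (reflect_dir e)"
  for e :: "'a::euclidean_space"
  by (auto simp: reflect_dir_def linear_iff algebra_simps intro!: linear_conv_bounded_linear[THEN iffD1])

lemma norm_reflect_dir:
  assumes "norm e = 1"
  shows "norm (reflect_dir e x) = norm x"
proof -
  have "e \<bullet> e = 1" using assms by (simp add: norm_eq_1)
  then have "reflect_dir e x \<bullet> reflect_dir e x = x \<bullet> x"
    by (simp add: reflect_dir_def inner_commute algebra_simps)
  then show ?thesis by (simp add: norm_eq)
qed

lemma isometry_reflect_dir:
  fixes e :: "'a::euclidean_space"
  assumes "norm e = 1"
  shows "isometry (\<lambda>x. reflect_dir e x + b)"
  using norm_reflect_dir[OF assms] linear_diff[OF bounded_linear.linear[OF bounded_linear_reflect_dir[of e]]]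
  by (simp add: isometry_def dist_norm) metis

lemma reflect_dir_rot90:
  assumes "norm e = 1"
  shows "reflect_dir e (rot90 x) = - rot90 (reflect_dir e x)"
proof -
  have "e $ 1 * e $ 1 + e $ 2 * e $ 2 = 1"
    using assms by (simp_all add: norm_eq_1 inner_vec_def sum_2)
  then have "- x $ 2 - 2 * (e $ 1 * - x $ 2 + e $ 2 * x $ 1) * e $ 1
      = x $ 2 - 2 * (e $ 1 * x $ 1 + e $ 2 * x $ 2) * e $ 2"
    "x $ 1 - 2 * (e $ 1 * - x $ 2 + e $ 2 * x $ 1) * e $ 2
      = - (x $ 1 - 2 * (e $ 1 * x $ 1 + e $ 2 * x $ 2) * e $ 1)"
    by algebra+
  then show ?thesis
    by (simp add: reflect_dir_def rot90_def vec_eq_iff forall_2 inner_vec_def sum_2)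
qed

lemma plane_curve_symmetric_if_curvature_even:
  fixes \<gamma> :: "real \<Rightarrow> real^2"
  assumes l: "l > 0" and \<gamma>: "arclen_param l \<gamma>"
    and nz: "\<And>s. s \<in> Jint l \<Longrightarrow> plane_curv l \<gamma> s \<noteq> 0"
    and even: "\<And>s. s \<in> Jint l \<Longrightarrow> plane_curv l \<gamma> (- s) = plane_curv l \<gamma> s"
  shows "has_symmetry (\<gamma> ` Jint l)"
proof -
  define e a where "e = nderiv 1 \<gamma> (Jint l)" and "a = nderiv 2 \<gamma> (Jint l)"
  define k where "k s = a s \<bullet> rot90 (e s)" for s
  note \<gamma>' = arclen_paramD[OF \<gamma>]
  have e1: "norm (e s) = 1" if "s \<in> Jint l" for s using \<gamma>'(3)[OF that] by (simp add: e_def)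
  have a: "a s = k s *\<^sub>R rot90 (e s)" if "s \<in> Jint l" for s
    unfolding k_def using perp_unit_eq_rot90[OF e1[OF that]] arclen_param_orthogonal[OF l \<gamma> that]
    by (simp add: e_def a_def)
  have absk: "\<bar>k s\<bar> = plane_curv l \<gamma> s" if "s \<in> Jint l" for s
    using arg_cong[OF a[OF that], of norm] e1[OF that] by (simp add: norm_rot90 plane_curv_def a_def)
  \<comment> \<open>Only the absolute value of the signed curvature \<open>k\<close> is known to be
    even. As it never vanishes, \<open>k\<close> keeps one sign by continuity, so \<open>k\<close>
    itself is even.\<close>
  have "continuous_on (Jint l) k"
    unfolding k_def e_def a_def
    by (intro continuous_on_inner bounded_linear.continuous_on[OF bounded_linear_rot90]
        smooth_on_continuous_nderiv \<gamma>')
  from continuous_nonzero_sign[OF this] absk nz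
  have ksign: "(\<forall>s\<in>Jint l. k s > 0) \<or> (\<forall>s\<in>Jint l. k s < 0)" by fastforce
  have keven: "k (- s) = k s" if "s \<in> Jint l" for s
    using ksign
  proof
    assume "\<forall>s\<in>Jint l. k s > 0"
    then have "k s > 0" "k (- s) > 0" using that by auto
    then show ?thesis using absk[OF that] absk[of "- s"] even[OF that] that by simp
  next
    assume "\<forall>s\<in>Jint l. k s < 0"
    then have "k s < 0" "k (- s) < 0" using that by auto
    then show ?thesis using absk[OF that] absk[of "- s"] even[OF that] that by simp
  qed
  have de: "(e has_vector_derivative a s) (at s within Jint l)" if "s \<in> Jint l" for s
    using smooth_onD_1[OF \<gamma>'(1) that] by (simp add: e_def a_def)
  have d\<gamma>: "(\<gamma> has_vector_derivative e s) (at s within Jint l)" if "s \<in> Jint l" for s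
    using smooth_onD_0[OF \<gamma>'(1) that] by (simp add: e_def)
  define R where "R = reflect_dir (e 0)"
  have R: "bounded_linear R" unfolding R_def by (rule bounded_linear_reflect_dir)
  have e0: "norm (e 0) = 1" using e1 zero_in_Jint[OF l] by blast
  \<comment> \<open>The reversed curve has velocity \<open>- e (- s)\<close>, so \<open>d\<close> is
    the difference between the reflected and the reversed tangent. Its derivative is a multiple of
    \<open>rot90 (d s)\<close>, orthogonal to \<open>d s\<close>; hence its norm is constant, and it
    is zero at 0 because \<open>R\<close> sends \<open>e 0\<close> to its negative.\<close>
  define d where "d s = R (e s) + e (- s)" for s
  have dd: "(d has_vector_derivative (- k s) *\<^sub>R rot90 (d s)) (at s within Jint l)" if s: "s \<in> Jint l" for s
  proof -
    have "(d has_vector_derivative R (a s) + - a (- s)) (at s within Jint l)"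
      unfolding d_def using s
      by (intro has_vector_derivative_add bounded_linear.has_vector_derivative[OF R]
          has_vector_derivative_reverse de) auto
    moreover have "R (a s) + - a (- s) = (- k s) *\<^sub>R rot90 (d s)"
    proof -
      have "R (a s) = - (k s *\<^sub>R rot90 (R (e s)))"
        using reflect_dir_rot90[OF e0] linear_simps(5)[OF R] unfolding a[OF s] by (simp add: R_def)
      moreover have "a (- s) = k s *\<^sub>R rot90 (e (- s))"
        using a[of "- s"] s keven[OF s] by simp
      ultimately show ?thesis
        by (simp add: d_def linear_simps(1)[OF bounded_linear_rot90] scaleR_add_right)
    qed
    ultimately show ?thesis by simp
  qed
  have "((\<lambda>s. d s \<bullet> d s) has_vector_derivative 0) (at s within Jint l)" if "s \<in> Jint l" for s
    using bounded_bilinear.has_vector_derivative[OF bounded_bilinear_inner dd[OF that] dd[OF that]]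
    by (simp add: inner_commute[of "rot90 _"] rot90_inner_self)
  from has_vector_derivative_zero_Jint[OF this]
  obtain q where q: "\<And>s. s \<in> Jint l \<Longrightarrow> d s \<bullet> d s = q" by blast
  have "d 0 = 0" using e0 by (simp add: d_def R_def reflect_dir_def dot_square_norm scaleR_2)
  then have d0: "d s = 0" if "s \<in> Jint l" for s
    using q[OF that] q[OF zero_in_Jint[OF l]] by simp
  have "((\<lambda>s. \<gamma> (- s) - R (\<gamma> s)) has_vector_derivative 0) (at s within Jint l)" if "s \<in> Jint l" for s
  proof -
    have "((\<lambda>s. \<gamma> (- s) - R (\<gamma> s)) has_vector_derivative - e (- s) - R (e s)) (at s within Jint l)"
      using that by (intro has_vector_derivative_diff bounded_linear.has_vector_derivative[OF R]
          has_vector_derivative_reverse d\<gamma>) auto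
    moreover have "- e (- s) - R (e s) = 0" using d0[OF that] by (simp add: d_def add_eq_0_iff)
    ultimately show ?thesis by simp
  qed
  from has_vector_derivative_zero_Jint[OF this]
  obtain b where "\<And>s. s \<in> Jint l \<Longrightarrow> \<gamma> (- s) - R (\<gamma> s) = b" by blast
  then have T: "R (\<gamma> s) + b = \<gamma> (- s)" if "s \<in> Jint l" for s
    using that by (metis add.commute diff_add_cancel)
  have "isometry (\<lambda>x. R x + b)" unfolding R_def by (rule isometry_reflect_dir[OF e0])
  moreover have "(\<lambda>x. R x + b) \<noteq> id"
  proof
    assume "(\<lambda>x. R x + b) = id"
    then have "\<gamma> (- (l/2)) = \<gamma> (l/2)" using T[OF endpoint_in_Jint[OF l]] by (metis id_apply)
    then show False
      using \<gamma>'(2) endpoint_in_Jint[OF l] l uminus_Jint_iff[of "l/2" l]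
      unfolding inj_on_def by fastforce
  qed
  moreover have "(\<lambda>x. R x + b) ` \<gamma> ` Jint l = \<gamma> ` Jint l"
    using T reverse_image_Jint[of \<gamma> l] by (simp add: image_image)
  ultimately show ?thesis unfolding has_symmetry_def by blast
qed

text \<open>A symmetry fixing the curve pointwise would force it onto a line, against nonvanishing
  curvature. The symmetry therefore reverses the curve, and comparing second derivatives at
  \<open>s\<close> and \<open>- s\<close> through an orthogonal matrix gives the claim.\<close>

lemma curvature_even_if_plane_curve_symmetric:
  fixes \<gamma> :: "real \<Rightarrow> real^2"
  assumes l: "l > 0" and \<gamma>: "arclen_param l \<gamma>"
    and nz: "\<And>s. s \<in> Jint l \<Longrightarrow> plane_curv l \<gamma> s \<noteq> 0"
    and sym: "has_symmetry (\<gamma> ` Jint l)" and s: "s \<in> Jint l"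
  shows "plane_curv l \<gamma> (- s) = plane_curv l \<gamma> s"
proof -
  note \<gamma>' = arclen_paramD[OF \<gamma>]
  obtain T where T: "isometry T" "T \<noteq> id" "T ` \<gamma> ` Jint l = \<gamma> ` Jint l"
    using sym by (auto simp: has_symmetry_def)
  obtain Q b where Q: "orthogonal_matrix Q" and TQ: "T = (\<lambda>x. Q *v x + b)"
    using isometry_affine[OF T(1)] .
  from symmetry_param_cases[OF l \<gamma> Q T(3)[unfolded TQ]] show ?thesis
  proof
    assume fixed: "\<forall>s\<in>Jint l. Q *v \<gamma> s + b = \<gamma> s"
    obtain n d where n: "n \<noteq> 0" "\<And>x. x \<in> \<gamma> ` Jint l \<Longrightarrow> n \<bullet> x = d"
    proof (rule isometry_fixing_hyperplane[OF T(1,2)])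
      show "T x = x" if "x \<in> \<gamma> ` Jint l" for x using fixed that by (auto simp: TQ)
    qed blast
    have L: "bounded_linear ((\<bullet>) n)" by (rule bounded_linear_inner_right)
    have n0: "n \<bullet> nderiv k \<gamma> (Jint l) s = 0" if "k > 0" for k
    proof -
      have "n \<bullet> nderiv k \<gamma> (Jint l) s = nderiv k (\<lambda>s. n \<bullet> \<gamma> s + - d) (Jint l) s"
        using smooth_on_affine(1)[OF l \<gamma>'(1) L s that, of "- d"] by simp
      also have "\<dots> = 0"
        by (rule nderiv_eqI(1)[OF l _ _ s, of "\<lambda>s. n \<bullet> \<gamma> s + - d" "\<lambda>k s. 0"]) (use n in auto)
      finally show ?thesis .
    qed
    \<comment> \<open>In the plane the normal \<open>n\<close> of the line and the second derivative
      are both orthogonal to the tangent, hence both nonzero multiples of \<open>rot90 ?e\<close>.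
      Their inner product cannot vanish, contradicting \<open>n0\<close> at order two.\<close>
    let ?e = "nderiv 1 \<gamma> (Jint l) s" and ?a = "nderiv 2 \<gamma> (Jint l) s"
    obtain x where x: "n = x *\<^sub>R rot90 ?e"
      using perp_unit_eq_rot90[of ?e n] \<gamma>'(3)[OF s] n0[of 1] by (auto simp: inner_commute)
    obtain y where y: "?a = y *\<^sub>R rot90 ?e"
      using perp_unit_eq_rot90[of ?e ?a] \<gamma>'(3)[OF s] arclen_param_orthogonal[OF l \<gamma> s] by auto
    have "rot90 ?e \<bullet> rot90 ?e = 1"
      using norm_rot90[of ?e] \<gamma>'(3)[OF s] by (simp add: norm_eq_1)
    then have "n \<bullet> ?a = x * y" unfolding y by (simp add: x)
    moreover have "x \<noteq> 0" using n(1) x by auto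
    moreover have "y \<noteq> 0" using nz[OF s] y by (auto simp: plane_curv_def)
    ultimately show ?thesis using n0[of 2] by simp
  next
    assume rev: "\<forall>s\<in>Jint l. Q *v \<gamma> s + b = \<gamma> (- s)"
    have L: "bounded_linear ((*v) Q)" by simp
    have "Q *v nderiv 2 \<gamma> (Jint l) s = nderiv 2 (\<lambda>s. Q *v \<gamma> s + b) (Jint l) s"
      using smooth_on_affine(1)[OF l \<gamma>'(1) L s, of 2 b] by simp
    also have "\<dots> = nderiv 2 (\<lambda>s. \<gamma> (- s)) (Jint l) s"
      using rev by (intro smooth_on_cong(1)[OF l smooth_on_reverse(2)[OF l \<gamma>'(1)] _ s]) auto
    also have "\<dots> = nderiv 2 \<gamma> (Jint l) (- s)"
      using smooth_on_reverse(1)[OF l \<gamma>'(1) s, of 2] by simp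
    finally show ?thesis
      using orthogonal_matrix_norm[OF Q] by (metis plane_curv_def)
  qed
qed

subsection \<open>Origami images under isometries and reversal\<close>

text \<open>Written as images of product sets, the sheets of two foldings can be compared pointwise
  by \<open>image_cong\<close>.\<close>

lemma origami_image_eq:
  "origami_image l c \<alpha> \<epsilon> =
     (\<lambda>(s, v). normal_form l c \<alpha> s v) ` Sigma (Jint l) (\<lambda>_. {0..<\<epsilon>})
     \<union> (\<lambda>(s, v). normal_form l c (\<lambda>t. - \<alpha> t) s v) ` Sigma (Jint l) (\<lambda>_. {-\<epsilon><..<0})"
  unfolding origami_image_def by (intro arg_cong2[where f="(\<union>)"]) (auto, blast+)

text \<open>An orthogonal map commutes with the cross product up to its determinant. The factor
  therefore appears in the torsion and the binormal, the two quantities containing one cross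
  product.\<close>

lemma frenet_affine:
  assumes l: "l > 0" and c: "arclen_param l c" and Q: "orthogonal_matrix Q" and s: "s \<in> Jint l"
  shows "kappa l (\<lambda>s. Q *v c s + b) s = kappa l c s"
    and "tau l (\<lambda>s. Q *v c s + b) s = det Q * tau l c s"
    and "frenet_e l (\<lambda>s. Q *v c s + b) s = Q *v frenet_e l c s"
    and "frenet_n l (\<lambda>s. Q *v c s + b) s = Q *v frenet_n l c s"
    and "frenet_b l (\<lambda>s. Q *v c s + b) s = det Q *\<^sub>R (Q *v frenet_b l c s)"
proof -
  have L: "bounded_linear ((*v) Q)" by simp
  have d: "nderiv k (\<lambda>s. Q *v c s + b) (Jint l) s = Q *v nderiv k c (Jint l) s" if "k > 0" for k
    using smooth_on_affine(1)[OF l arclen_paramD(1)[OF c] L s that] .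
  show k: "kappa l (\<lambda>s. Q *v c s + b) s = kappa l c s"
    by (simp add: kappa_def d orthogonal_matrix_norm[OF Q])
  show "tau l (\<lambda>s. Q *v c s + b) s = det Q * tau l c s"
    unfolding tau_def k
    by (simp add: d cross_orthogonal_matrix[OF Q] orthogonal_matrix_inner[OF Q])
  show e: "frenet_e l (\<lambda>s. Q *v c s + b) s = Q *v frenet_e l c s"
    by (simp add: frenet_e_def d)
  show n: "frenet_n l (\<lambda>s. Q *v c s + b) s = Q *v frenet_n l c s"
    unfolding frenet_n_def k by (simp add: d matrix_vector_mult_scaleR)
  show "frenet_b l (\<lambda>s. Q *v c s + b) s = det Q *\<^sub>R (Q *v frenet_b l c s)"
    unfolding frenet_b_def e n by (simp add: cross_orthogonal_matrix[OF Q])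
qed

text \<open>With the angle multiplied by \<open>det Q\<close>, numerator and denominator of the
  cotangent of beta acquire the same sign, so beta is unchanged. In the frame, the sign of the sine
  cancels against that of the binormal.\<close>

lemma ruling_affine:
  assumes l: "l > 0" and c: "arclen_param l c" and Q: "orthogonal_matrix Q" and s: "s \<in> Jint l"
    and \<alpha>: "smooth_on (Jint l) \<alpha>"
  shows "ruling l (\<lambda>s. Q *v c s + b) (\<lambda>s. det Q * \<alpha> s) s = Q *v ruling l c \<alpha> s"
proof -
  note F = frenet_affine[OF l c Q s, of b]
  have d\<alpha>: "nderiv 1 (\<lambda>s. det Q * \<alpha> s) (Jint l) s = det Q * nderiv 1 \<alpha> (Jint l) s"
    using smooth_on_scaleR(1)[OF l \<alpha> s, of 1 "det Q"] by simp
  have det: "det Q = 1 \<or> det Q = -1" by (rule det_orthogonal_matrix[OF Q])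
  have \<beta>: "beta_ang l (\<lambda>s. Q *v c s + b) (\<lambda>s. det Q * \<alpha> s) s = beta_ang l c \<alpha> s"
  proof -
    have "(det Q * x + det Q * t) / (k * sin (det Q * a)) = (x + t) / (k * sin a)" for x t k a :: real
      using det
    proof
      assume d: "det Q = -1"
      have "(det Q * x + det Q * t) / (k * sin (det Q * a)) = (- (x + t)) / (- (k * sin a))"
        by (simp add: d)
      then show ?thesis by (simp only: minus_divide_divide)
    qed simp
    then show ?thesis unfolding beta_ang_def F d\<alpha> by (simp only:)
  qed
  have frame: "x *\<^sub>R (Q *v u) + y *\<^sub>R (cos (det Q * a) *\<^sub>R (Q *v v) + sin (det Q * a) *\<^sub>R (det Q *\<^sub>R (Q *v w)))
      = Q *v (x *\<^sub>R u + y *\<^sub>R (cos a *\<^sub>R v + sin a *\<^sub>R w))" for x y a u v w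
    using det
    by (elim disjE) (simp_all add: matrix_vector_right_distrib matrix_vector_mult_scaleR)
  show ?thesis
    unfolding ruling_def \<beta> F by (rule frame)
qed

lemma origami_image_affine:
  assumes l: "l > 0" and c: "arclen_param l c" and Q: "orthogonal_matrix Q"
    and \<alpha>: "smooth_on (Jint l) \<alpha>"
  shows "(\<lambda>x. Q *v x + b) ` origami_image l c \<alpha> \<epsilon>
       = origami_image l (\<lambda>s. Q *v c s + b) (\<lambda>s. det Q * \<alpha> s) \<epsilon>"
proof -
  have nf: "normal_form l (\<lambda>s. Q *v c s + b) (\<lambda>s. det Q * a s) s v = Q *v normal_form l c a s v + b"
    if "smooth_on (Jint l) a" "s \<in> Jint l" for a s v
    unfolding normal_form_def
    by (simp add: ruling_affine[OF l c Q that(2,1)] matrix_vector_right_distrib matrix_vector_mult_scaleR)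
  note 1 = nf[OF \<alpha>] and 2 = nf[OF smooth_on_minus(2)[OF l \<alpha>], simplified]
  show ?thesis
    unfolding origami_image_eq image_Un image_image
    by (intro arg_cong2[where f="(\<union>)"] image_cong) (auto simp: 1 2)
qed

text \<open>A derivative of order k acquires the sign (-1)^k. In the torsion the orders 1 and 3
  contribute two signs, which cancel.\<close>

lemma frenet_reverse:
  assumes l: "l > 0" and c: "arclen_param l c" and s: "s \<in> Jint l"
  shows "kappa l (\<lambda>s. c (- s)) s = kappa l c (- s)"
    and "tau l (\<lambda>s. c (- s)) s = tau l c (- s)"
    and "frenet_e l (\<lambda>s. c (- s)) s = - frenet_e l c (- s)"
    and "frenet_n l (\<lambda>s. c (- s)) s = frenet_n l c (- s)"
    and "frenet_b l (\<lambda>s. c (- s)) s = - frenet_b l c (- s)"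
proof -
  note d = smooth_on_reverse(1)[OF l arclen_paramD(1)[OF c] s]
  show k: "kappa l (\<lambda>s. c (- s)) s = kappa l c (- s)"
    by (simp add: kappa_def d)
  show "tau l (\<lambda>s. c (- s)) s = tau l c (- s)"
    unfolding tau_def k by (simp add: d)
  show e: "frenet_e l (\<lambda>s. c (- s)) s = - frenet_e l c (- s)"
    by (simp add: frenet_e_def d)
  show n: "frenet_n l (\<lambda>s. c (- s)) s = frenet_n l c (- s)"
    unfolding frenet_n_def k by (simp add: d)
  show "frenet_b l (\<lambda>s. c (- s)) s = - frenet_b l c (- s)"
    unfolding frenet_b_def e n by simp
qed

text \<open>Reversal flips \<open>e\<close> and \<open>b\<close> but keeps \<open>n\<close>, hence the change of sign of the angle.\<close>

lemma ruling_reverse: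
  assumes l: "l > 0" and c: "arclen_param l c" and s: "s \<in> Jint l" and \<alpha>: "smooth_on (Jint l) \<alpha>"
  shows "ruling l (\<lambda>s. c (- s)) (\<lambda>s. - \<alpha> (- s)) s = ruling l c \<alpha> (- s)"
proof -
  note F = frenet_reverse[OF l c s]
  have d\<alpha>: "nderiv 1 (\<lambda>s. - \<alpha> (- s)) (Jint l) s = nderiv 1 \<alpha> (Jint l) (- s)"
    using smooth_on_minus(1)[OF l smooth_on_reverse(2)[OF l \<alpha>] s, of 1] smooth_on_reverse(1)[OF l \<alpha> s, of 1]
    by simp
  \<comment> \<open>The sum of angle derivative and torsion keeps its sign while the sine of the
    angle changes it, so the cotangent is negated. The resulting sign of \<open>cos\<close>
    compensates the reversed tangent in the ruling.\<close>
  have \<beta>: "beta_ang l (\<lambda>s. c (- s)) (\<lambda>s. - \<alpha> (- s)) s = pi - beta_ang l c \<alpha> (- s)"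
    unfolding beta_ang_def F d\<alpha> by (simp add: arctan_minus)
  show ?thesis
    unfolding ruling_def \<beta> F by simp
qed

lemma origami_image_reverse:
  assumes l: "l > 0" and c: "arclen_param l c" and \<alpha>: "smooth_on (Jint l) \<alpha>"
  shows "origami_image l (\<lambda>s. c (- s)) (\<lambda>s. - \<alpha> (- s)) \<epsilon> = origami_image l c \<alpha> \<epsilon>"
proof -
  have nf: "normal_form l (\<lambda>s. c (- s)) (\<lambda>s. - a (- s)) s v = normal_form l c a (- s) v"
    if "smooth_on (Jint l) a" "s \<in> Jint l" for a s v
    unfolding normal_form_def by (simp add: ruling_reverse[OF l c that(2,1)])
  have re: "(\<lambda>(s, v). normal_form l (\<lambda>s. c (- s)) (\<lambda>s. - a (- s)) s v) ` Sigma (Jint l) (\<lambda>_. V)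
      = (\<lambda>(s, v). normal_form l c a s v) ` Sigma (Jint l) (\<lambda>_. V)" if a: "smooth_on (Jint l) a" for a V
  proof -
    have flip: "Sigma (Jint l) (\<lambda>_. V) = (\<lambda>(s, v). (- s, v)) ` Sigma (Jint l) (\<lambda>_. V)"
    proof (intro equalityI subsetI)
      fix p assume "p \<in> Sigma (Jint l) (\<lambda>_. V)"
      then show "p \<in> (\<lambda>(s, v). (- s, v)) ` Sigma (Jint l) (\<lambda>_. V)"
        by (intro image_eqI[of _ _ "(- fst p, snd p)"]) auto
    qed auto
    have "(\<lambda>(s, v). normal_form l c a s v) ` Sigma (Jint l) (\<lambda>_. V)
        = (\<lambda>(s, v). normal_form l c a s v) ` (\<lambda>(s, v). (- s, v)) ` Sigma (Jint l) (\<lambda>_. V)"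
      by (rule arg_cong[OF flip])
    also have "\<dots> = (\<lambda>(s, v). normal_form l c a (- s) v) ` Sigma (Jint l) (\<lambda>_. V)"
      by (simp add: image_image case_prod_beta)
    also have "\<dots> = (\<lambda>(s, v). normal_form l (\<lambda>s. c (- s)) (\<lambda>s. - a (- s)) s v) ` Sigma (Jint l) (\<lambda>_. V)"
      by (intro image_cong) (auto simp: nf[OF a])
    finally show ?thesis by simp
  qed
  show ?thesis
    unfolding origami_image_eq
    using re[OF \<alpha>] re[OF smooth_on_minus(2)[OF l \<alpha>]] by simp
qed

lemma frenet_cong:
  assumes l: "l > 0" and c: "arclen_param l c" and c': "\<And>s. s \<in> Jint l \<Longrightarrow> c' s = c s" and s: "s \<in> Jint l"
  shows "kappa l c' s = kappa l c s" "tau l c' s = tau l c s"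
    "frenet_e l c' s = frenet_e l c s" "frenet_n l c' s = frenet_n l c s" "frenet_b l c' s = frenet_b l c s"
proof -
  have d: "nderiv k c' (Jint l) s = nderiv k c (Jint l) s" for k
    by (rule smooth_on_cong(1)[OF l arclen_paramD(1)[OF c] c' s])
  show "kappa l c' s = kappa l c s" "tau l c' s = tau l c s"
    "frenet_e l c' s = frenet_e l c s" "frenet_n l c' s = frenet_n l c s" "frenet_b l c' s = frenet_b l c s"
    by (simp_all add: kappa_def tau_def frenet_e_def frenet_n_def frenet_b_def d)
qed

lemma origami_image_cong:
  assumes l: "l > 0" and c: "arclen_param l c" and \<alpha>: "smooth_on (Jint l) \<alpha>"
    and c': "\<And>s. s \<in> Jint l \<Longrightarrow> c' s = c s" and \<alpha>': "\<And>s. s \<in> Jint l \<Longrightarrow> \<alpha>' s = \<alpha> s"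
  shows "origami_image l c' \<alpha>' \<epsilon> = origami_image l c \<alpha> \<epsilon>"
proof -
  have nf: "normal_form l c' a' s v = normal_form l c a s v"
    if "smooth_on (Jint l) a" "\<And>s. s \<in> Jint l \<Longrightarrow> a' s = a s" "s \<in> Jint l" for a a' s v
    using frenet_cong[OF l c c' that(3)] smooth_on_cong(1)[OF l that] that c'
    by (simp add: normal_form_def ruling_def beta_ang_def)
  note 1 = nf[OF \<alpha> \<alpha>']
  have 2: "normal_form l c' (\<lambda>s. - \<alpha>' s) s v = normal_form l c (\<lambda>s. - \<alpha> s) s v" if "s \<in> Jint l" for s v
    using nf[OF smooth_on_minus(2)[OF l \<alpha>], of "\<lambda>s. - \<alpha>' s" s v] \<alpha>' that by simp
  show ?thesis
    unfolding origami_image_eq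
    by (intro arg_cong2[where f="(\<union>)"] image_cong) (auto simp: 1 2)
qed

section \<open>Frenet frame and rulings along an arc of nonvanishing curvature\<close>

locale regular_arc =
  fixes l :: real and c :: "real \<Rightarrow> real^3"
  assumes l_pos: "l > 0" and arclen: "arclen_param l c"
    and nonzero_curv: "\<And>s. s \<in> Jint l \<Longrightarrow> nderiv 2 c (Jint l) s \<noteq> 0"
begin

abbreviation "J \<equiv> Jint l"
abbreviation "\<kappa> \<equiv> kappa l c"
abbreviation "e \<equiv> frenet_e l c"
abbreviation "n \<equiv> frenet_n l c"
abbreviation "b \<equiv> frenet_b l c"

lemmas smooth_c = arclen_paramD(1)[OF arclen]
  and inj_c = arclen_paramD(2)[OF arclen]
  and speed_c = arclen_paramD(3)[OF arclen]

lemma kappa_pos: "s \<in> J \<Longrightarrow> \<kappa> s > 0"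
  using nonzero_curv by (simp add: kappa_def)

lemma frenet_orthonormal:
  assumes s: "s \<in> J"
  shows "e s \<bullet> e s = 1" "n s \<bullet> n s = 1" "b s \<bullet> b s = 1"
    "e s \<bullet> n s = 0" "e s \<bullet> b s = 0" "n s \<bullet> b s = 0"
    "n s \<bullet> e s = 0" "b s \<bullet> e s = 0" "b s \<bullet> n s = 0"
proof -
  show e: "e s \<bullet> e s = 1" using speed_c[OF s] by (simp add: frenet_e_def norm_eq_1)
  have "norm (n s) = 1" using kappa_pos[OF s] by (simp add: frenet_n_def kappa_def)
  then show n: "n s \<bullet> n s = 1" by (simp add: norm_eq_1)
  show en: "e s \<bullet> n s = 0"
    using arclen_param_orthogonal[OF l_pos arclen s] by (simp add: frenet_e_def frenet_n_def)
  show "e s \<bullet> b s = 0" "n s \<bullet> b s = 0" "n s \<bullet> e s = 0" "b s \<bullet> e s = 0" "b s \<bullet> n s = 0"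
    using en by (simp_all add: frenet_b_def dot_cross_self inner_commute)
  show "b s \<bullet> b s = 1"
    using norm_cross_dot[of "e s" "n s"] e n en
    by (simp add: frenet_b_def dot_square_norm power_mult_distrib)
qed

text \<open>Smoothness and range only; the inequality between \<open>\<kappa> cos \<alpha>\<close>
  and the infimum of the curvature is carried separately, as in \<open>P_star_iff\<close>.\<close>

definition admissible_angle :: "(real \<Rightarrow> real) \<Rightarrow> bool" where
  "admissible_angle \<alpha> \<longleftrightarrow> smooth_on J \<alpha> \<and> (\<forall>s\<in>J. 0 < \<bar>\<alpha> s\<bar> \<and> \<bar>\<alpha> s\<bar> < pi/2)"

lemma admissible_angle_minus: "admissible_angle \<alpha> \<Longrightarrow> admissible_angle (\<lambda>s. - \<alpha> s)"
  by (auto simp: admissible_angle_def smooth_on_minus(2)[OF l_pos])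

text \<open>The angle is pi/2 minus an arctan, so its sine is the cosine of an arctan.
  Geometrically, the rulings along the arc are transversal to it.\<close>

lemma sin_beta_pos: "sin (beta_ang l c \<alpha> s) > 0"
  by (simp add: beta_ang_def sin_diff cos_arctan add_pos_nonneg)

lemma ruling_inner:
  assumes "s \<in> J"
  shows "ruling l c \<alpha> s \<bullet> n s = sin (beta_ang l c \<alpha> s) * cos (\<alpha> s)"
    "ruling l c \<alpha> s \<bullet> b s = sin (beta_ang l c \<alpha> s) * sin (\<alpha> s)"
  by (simp_all add: ruling_def inner_add_left frenet_orthonormal[OF assms] algebra_simps)

lemma norm_ruling:
  assumes "s \<in> J"
  shows "norm (ruling l c \<alpha> s) = 1"
proof -
  have "(x *\<^sub>R e s + y *\<^sub>R (p *\<^sub>R n s + q *\<^sub>R b s)) \<bullet> (x *\<^sub>R e s + y *\<^sub>R (p *\<^sub>R n s + q *\<^sub>R b s))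
      = x * x + y * y * (p * p + q * q)" for x y p q
    by (simp add: inner_add_left inner_add_right frenet_orthonormal[OF assms]) (simp add: algebra_simps)
  then show ?thesis by (simp add: norm_eq_1 ruling_def)
qed

lemma continuous_ruling:
  assumes "admissible_angle \<alpha>"
  shows "continuous_on J (ruling l c \<alpha>)"
proof -
  have \<alpha>: "smooth_on J \<alpha>" "\<And>s. s \<in> J \<Longrightarrow> 0 < \<bar>\<alpha> s\<bar> \<and> \<bar>\<alpha> s\<bar> < pi/2"
    using assms by (auto simp: admissible_angle_def)
  have sin: "sin (\<alpha> s) \<noteq> 0" if "s \<in> J" for s
    using \<alpha>(2)[OF that] sin_eq_0_pi[of "\<alpha> s"] pi_gt_zero by (auto simp: abs_if split: if_splits)
  note cont = smooth_on_continuous_nderiv[OF smooth_c] smooth_on_continuous_nderiv[OF \<alpha>(1)] smooth_on_continuous[OF \<alpha>(1)]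
  have \<kappa>: "continuous_on J \<kappa>" unfolding kappa_def[abs_def] by (intro continuous_intros cont)
  have e: "continuous_on J e" unfolding frenet_e_def[abs_def] by (intro cont)
  have n: "continuous_on J n" unfolding frenet_n_def[abs_def]
    using kappa_pos by (intro continuous_intros cont \<kappa>) force
  have b: "continuous_on J b" unfolding frenet_b_def[abs_def] by (intro continuous_on_cross e n)
  have \<tau>: "continuous_on J (tau l c)" unfolding tau_def[abs_def]
    using kappa_pos by (intro continuous_intros continuous_on_cross cont \<kappa>) force
  have \<beta>: "continuous_on J (beta_ang l c \<alpha>)" unfolding beta_ang_def[abs_def]
    using kappa_pos sin by (intro continuous_intros cont \<kappa> \<tau>) force
  show ?thesis unfolding ruling_def[abs_def] by (intro continuous_intros cont \<beta> e n b)
qed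

end

subsection \<open>The germ of a curved folding determines its angle\<close>

text \<open>The chord is \<open>(t k - s) *\<^sub>R u\<close> up to a remainder that is small
  relative to \<open>t k - s\<close>. Its length bound makes \<open>t k - s\<close> at most of order
  \<open>v k\<close>, so the component orthogonal to \<open>u\<close>, which sees only the
  remainder, is negligible against \<open>v k\<close>.\<close>

lemma secant_normal_component_tendsto:
  fixes c :: "real \<Rightarrow> 'a::real_inner"
  assumes deriv: "(c has_vector_derivative u) (at s within S)" and u: "norm u = 1"
    and t: "\<And>k. t k \<in> S" "t \<longlonglongrightarrow> s"
    and v: "\<And>k. v k > 0" and bound: "\<And>k. norm (c (t k) - c s) \<le> K * v k"
    and \<nu>: "u \<bullet> \<nu> = 0"
  shows "(\<lambda>k. ((c (t k) - c s) \<bullet> \<nu>) / v k) \<longlonglongrightarrow> 0"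
proof -
  have K: "K \<ge> 0"
    using bound[of 0] v[of 0] norm_ge_zero[of "c (t 0) - c s"] by (smt (verit) mult_neg_pos)
  have rem: "\<forall>\<^sub>F k in sequentially. norm (c (t k) - c s - (t k - s) *\<^sub>R u) \<le> \<eta> * \<bar>t k - s\<bar>" if \<eta>: "\<eta> > 0" for \<eta>
  proof -
    obtain d where d: "d > 0" "\<And>y. y \<in> S \<Longrightarrow> norm (y - s) < d \<Longrightarrow> norm (c y - c s - (y - s) *\<^sub>R u) \<le> \<eta> * norm (y - s)"
      using deriv[unfolded has_vector_derivative_def has_derivative_within_alt, THEN conjunct2, rule_format, OF \<eta>]
      by blast
    have "\<forall>\<^sub>F k in sequentially. dist (t k) s < d" using t(2) d(1) by (rule tendstoD)
    then show ?thesis by eventually_elim (use d(2) t(1) in \<open>auto simp: dist_norm\<close>)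
  qed
  have half: "\<forall>\<^sub>F k in sequentially. \<bar>t k - s\<bar> \<le> 2 * K * v k"
    using rem[of "1/2", simplified]
  proof eventually_elim
    case (elim k)
    have "\<bar>t k - s\<bar> = norm ((t k - s) *\<^sub>R u)" using u by simp
    also have "\<dots> \<le> norm (c (t k) - c s) + norm (c (t k) - c s - (t k - s) *\<^sub>R u)"
      by (metis norm_minus_commute norm_triangle_sub)
    finally show ?case using elim bound[of k] by simp
  qed
  show ?thesis
  proof (rule tendstoI)
    fix \<epsilon> :: real assume \<epsilon>: "\<epsilon> > 0"
    \<comment> \<open>The summand 1 keeps the denominator positive when \<open>K\<close> or
      \<open>\<nu>\<close> is zero.\<close>
    define \<eta> where "\<eta> = \<epsilon> / (2 * K * norm \<nu> + 1)"
    have den: "2 * K * norm \<nu> + 1 > 0" using K by (simp add: add_nonneg_pos)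
    then have \<eta>: "\<eta> > 0" using \<epsilon> by (simp add: \<eta>_def)
    from rem[OF \<eta>] half
    show "\<forall>\<^sub>F k in sequentially. dist (((c (t k) - c s) \<bullet> \<nu>) / v k) 0 < \<epsilon>"
    proof eventually_elim
      case (elim k)
      have "\<bar>(c (t k) - c s) \<bullet> \<nu>\<bar> = \<bar>(c (t k) - c s - (t k - s) *\<^sub>R u) \<bullet> \<nu>\<bar>"
        using \<nu> by (simp add: inner_diff_left)
      also have "\<dots> \<le> norm (c (t k) - c s - (t k - s) *\<^sub>R u) * norm \<nu>"
        by (rule Cauchy_Schwarz_ineq2)
      also have "\<dots> \<le> (\<eta> * (2 * K * v k)) * norm \<nu>"
        using elim \<eta> by (intro mult_right_mono) (auto intro: order_trans mult_left_mono)
      also have "\<dots> = (\<eta> * (2 * K * norm \<nu>)) * v k" by simp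
      also have "\<dots> < (\<eta> * (2 * K * norm \<nu> + 1)) * v k"
        using \<eta> v[of k] by (intro mult_strict_right_mono) (auto simp: algebra_simps)
      also have "\<dots> = \<epsilon> * v k" using den by (simp add: \<eta>_def)
      finally show ?case using v[of k] by (simp add: dist_norm pos_divide_less_eq)
    qed
  qed
qed

context regular_arc
begin

text \<open>Rulings are unit vectors, so the image of width epsilon stays within epsilon of the arc,
  which is closed; conversely \<open>v = 0\<close> gives the arc itself. Thus the germ determines
  the curve.\<close>

lemma origami_image_Inter:
  assumes \<epsilon>0: "\<epsilon>0 > 0"
  shows "(\<forall>\<epsilon>. 0 < \<epsilon> \<and> \<epsilon> < \<epsilon>0 \<longrightarrow> x \<in> origami_image l c \<alpha> \<epsilon>) \<longleftrightarrow> x \<in> c ` J"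
proof
  assume "x \<in> c ` J"
  then obtain s where "s \<in> J" "x = c s" by auto
  then show "\<forall>\<epsilon>. 0 < \<epsilon> \<and> \<epsilon> < \<epsilon>0 \<longrightarrow> x \<in> origami_image l c \<alpha> \<epsilon>"
    unfolding origami_image_eq by (auto simp: normal_form_def intro!: image_eqI[of _ _ "(s, 0)"])
next
  assume x: "\<forall>\<epsilon>. 0 < \<epsilon> \<and> \<epsilon> < \<epsilon>0 \<longrightarrow> x \<in> origami_image l c \<alpha> \<epsilon>"
  have "closed (c ` J)"
    using compact_continuous_image[OF smooth_on_continuous[OF smooth_c] compact_Jint] by (rule compact_imp_closed)
  moreover have "\<exists>y\<in>c ` J. dist y x < \<epsilon>" if \<epsilon>: "\<epsilon> > 0" for \<epsilon>
  proof -
    define r where "r = min \<epsilon> \<epsilon>0 / 2"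
    have r: "0 < r" "r < \<epsilon>0" "r < \<epsilon>" using \<epsilon> \<epsilon>0 by (auto simp: r_def)
    then have "x \<in> origami_image l c \<alpha> r" using x by blast
    then have "\<exists>s v a. s \<in> J \<and> \<bar>v\<bar> < r \<and> x = c s + v *\<^sub>R ruling l c a s"
      unfolding origami_image_def normal_form_def
    proof (elim UnE CollectE exE conjE)
      fix s v assume "x = c s + v *\<^sub>R ruling l c \<alpha> s" "s \<in> J" "0 \<le> v" "v < r"
      then show ?thesis by (intro exI[of _ s] exI[of _ v] exI[of _ \<alpha>]) auto
    next
      fix s v assume "x = c s + v *\<^sub>R ruling l c (\<lambda>t. - \<alpha> t) s" "s \<in> J" "- r < v" "v < 0"
      then show ?thesis by (intro exI[of _ s] exI[of _ v] exI[of _ "\<lambda>t. - \<alpha> t"]) auto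
    qed
    then obtain s v a where "s \<in> J" "\<bar>v\<bar> < r" "x = c s + v *\<^sub>R ruling l c a s" by blast
    then have "dist (c s) x < \<epsilon>" using norm_ruling[of s a] r by (simp add: dist_norm)
    with \<open>s \<in> J\<close> show ?thesis by blast
  qed
  ultimately show "x \<in> c ` J" by (metis closure_approachable closure_eq)
qed

lemma tendsto_param:
  assumes "\<And>k. t k \<in> J" "s \<in> J" "(\<lambda>k. c (t k)) \<longlonglongrightarrow> c s"
  shows "t \<longlonglongrightarrow> s"
proof -
  have "(\<lambda>k. the_inv_into J c (c (t k))) \<longlonglongrightarrow> the_inv_into J c (c s)"
    by (rule continuous_on_tendsto_compose[OF
          continuous_on_inv_into[OF smooth_on_continuous[OF smooth_c] compact_Jint inj_c] assms(3)])
       (use assms in auto)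
  then show ?thesis using assms by (simp add: the_inv_into_f_f[OF inj_c])
qed

text \<open>Points of the first sheet over \<open>c s\<close> at distance \<open>v \<rightarrow> 0\<close> lie in the second image; dividing by
  \<open>v\<close> and projecting along the tangent compares the two rulings in the normal plane. The component
  along \<open>n\<close> excludes the sheet of the dual strip; the remaining component is \<open>sin (\<alpha> s - \<alpha>' s)\<close>.\<close>

lemma origami_germ_determines_angle:
  assumes \<alpha>: "admissible_angle \<alpha>" and \<alpha>': "admissible_angle \<alpha>'" and \<epsilon>0: "\<epsilon>0 > 0"
    and sub: "\<And>\<epsilon>. 0 < \<epsilon> \<Longrightarrow> \<epsilon> < \<epsilon>0 \<Longrightarrow> origami_image l c \<alpha> \<epsilon> \<subseteq> origami_image l c \<alpha>' \<epsilon>"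
    and s: "s \<in> J"
  shows "\<alpha> s = \<alpha>' s"
proof -
  define r1 where "r1 = ruling l c \<alpha>'"
  define r2 where "r2 = ruling l c (\<lambda>t. - \<alpha>' t)"
  \<comment> \<open>The offset 3 keeps \<open>2 * v k\<close> below \<open>\<epsilon>0\<close> from
    \<open>k = 0\<close> on. Images of width \<open>2 * v k\<close> are compared because the width
    must exceed \<open>v k\<close> strictly.\<close>
  define v where "v k = \<epsilon>0 / real (k + 3)" for k
  have v: "v k > 0" "2 * v k < \<epsilon>0" for k
    using \<epsilon>0 by (auto simp: v_def field_simps intro: add_pos_nonneg)
  have v0: "v \<longlonglongrightarrow> 0"
    unfolding v_def by (rule LIMSEQ_ignore_initial_segment[OF lim_const_over_n])
  have "\<exists>t w. t \<in> J \<and> \<bar>w\<bar> \<le> 2 * v k \<and>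
      (0 \<le> w \<and> c s + v k *\<^sub>R ruling l c \<alpha> s = c t + w *\<^sub>R r1 t \<or>
       w < 0 \<and> c s + v k *\<^sub>R ruling l c \<alpha> s = c t + w *\<^sub>R r2 t)" for k
  proof -
    have "c s + v k *\<^sub>R ruling l c \<alpha> s \<in> origami_image l c \<alpha> (2 * v k)"
      unfolding origami_image_eq using v[of k] s by (auto simp: normal_form_def intro!: image_eqI[of _ _ "(s, v k)"])
    then have "c s + v k *\<^sub>R ruling l c \<alpha> s \<in> origami_image l c \<alpha>' (2 * v k)"
      using sub[of "2 * v k"] v[of k] by auto
    then show ?thesis
      unfolding origami_image_def normal_form_def
    proof (elim UnE CollectE exE conjE)
      fix t w assume "c s + v k *\<^sub>R ruling l c \<alpha> s = c t + w *\<^sub>R ruling l c \<alpha>' t" "t \<in> J" "0 \<le> w" "w < 2 * v k"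
      then show ?thesis by (intro exI[of _ t] exI[of _ w]) (auto simp: r1_def)
    next
      fix t w assume "c s + v k *\<^sub>R ruling l c \<alpha> s = c t + w *\<^sub>R ruling l c (\<lambda>t. - \<alpha>' t) t"
        "t \<in> J" "- (2 * v k) < w" "w < 0"
      then show ?thesis by (intro exI[of _ t] exI[of _ w]) (auto simp: r2_def)
    qed
  qed
  then obtain t w where t: "\<And>k. t k \<in> J" and w: "\<And>k. \<bar>w k\<bar> \<le> 2 * v k"
    and tw: "\<And>k. 0 \<le> w k \<and> c s + v k *\<^sub>R ruling l c \<alpha> s = c (t k) + w k *\<^sub>R r1 (t k) \<or>
       w k < 0 \<and> c s + v k *\<^sub>R ruling l c \<alpha> s = c (t k) + w k *\<^sub>R r2 (t k)"
    by metis
  have bound: "norm (c (t k) - c s) \<le> 3 * v k" for k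
  proof -
    obtain r where r: "norm r = 1" "c s + v k *\<^sub>R ruling l c \<alpha> s = c (t k) + w k *\<^sub>R r"
      using tw[of k] norm_ruling[OF t[of k]] unfolding r1_def r2_def by metis
    then have "c (t k) - c s = v k *\<^sub>R ruling l c \<alpha> s - w k *\<^sub>R r" by (simp add: algebra_simps)
    then have "norm (c (t k) - c s) \<le> norm (v k *\<^sub>R ruling l c \<alpha> s) + norm (w k *\<^sub>R r)"
      by (metis norm_triangle_ineq4)
    then show ?thesis using r(1) norm_ruling[OF s] w[of k] v(1)[of k] by simp
  qed
  have "(\<lambda>k. c (t k) - c s) \<longlonglongrightarrow> 0"
    by (rule Lim_null_comparison[of _ "\<lambda>k. 3 * v k"])
       (use bound tendsto_mult_right_zero[OF v0, of 3] in auto)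
  then have ts: "t \<longlonglongrightarrow> s"
    using tendsto_param[OF t s] by (simp add: LIM_zero_iff)
  have secant: "(\<lambda>k. ((c (t k) - c s) \<bullet> \<nu>) / v k) \<longlonglongrightarrow> 0" if "e s \<bullet> \<nu> = 0" for \<nu>
    by (rule secant_normal_component_tendsto[OF smooth_onD_0[OF smooth_c s] speed_c[OF s] t ts v(1) bound])
       (use that in \<open>simp add: frenet_e_def\<close>)
  have r1: "(\<lambda>k. r1 (t k)) \<longlonglongrightarrow> r1 s" and r2: "(\<lambda>k. r2 (t k)) \<longlonglongrightarrow> r2 s"
    unfolding r1_def r2_def using t s
    by (auto intro!: continuous_on_tendsto_compose[OF continuous_ruling ts] admissible_angle_minus \<alpha>')
  have expand: "ruling l c \<alpha> s \<bullet> \<nu> = ((c (t k) - c s) \<bullet> \<nu>) / v k + (w k / v k) * (r \<bullet> \<nu>)"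
    if "c s + v k *\<^sub>R ruling l c \<alpha> s = c (t k) + w k *\<^sub>R r" for k r \<nu>
  proof -
    have "v k *\<^sub>R ruling l c \<alpha> s = (c (t k) - c s) + w k *\<^sub>R r" using that by (simp add: algebra_simps)
    then have "v k * (ruling l c \<alpha> s \<bullet> \<nu>) = (c (t k) - c s) \<bullet> \<nu> + w k * (r \<bullet> \<nu>)"
      by (metis inner_add_left inner_scaleR_left)
    then show ?thesis using v(1)[of k] by (simp add: field_simps)
  qed
  have ang: "\<bar>\<alpha> s\<bar> < pi/2" "\<bar>\<alpha>' s\<bar> < pi/2"
    using \<alpha> \<alpha>' s by (auto simp: admissible_angle_def)
  then have cos: "cos (\<alpha> s) > 0" "cos (\<alpha>' s) > 0"
    by (auto intro!: cos_gt_zero_pi)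
  \<comment> \<open>Both the given ruling and the dual one point to the side of the principal
    normal. On the dual sheet \<open>w\<close> is negative, so the two normal components would have
    opposite signs up to a negligible chord term.\<close>
  have "ruling l c \<alpha> s \<bullet> n s > 0"
    using ruling_inner(1)[OF s] sin_beta_pos cos by simp
  moreover have "r2 s \<bullet> n s > 0"
    unfolding r2_def using ruling_inner(1)[OF s] sin_beta_pos cos by simp
  ultimately have "\<forall>\<^sub>F k in sequentially. ((c (t k) - c s) \<bullet> n s) / v k < ruling l c \<alpha> s \<bullet> n s \<and> r2 (t k) \<bullet> n s > 0"
    using order_tendstoD(2)[OF secant[of "n s"]] order_tendstoD(1)[OF tendsto_inner[OF r2 tendsto_const]]
      frenet_orthonormal(4)[OF s] by (auto intro: eventually_conj)
  then have sheet: "\<forall>\<^sub>F k in sequentially. c s + v k *\<^sub>R ruling l c \<alpha> s = c (t k) + w k *\<^sub>R r1 (t k)"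
  proof eventually_elim
    case (elim k)
    have False if "w k < 0" "c s + v k *\<^sub>R ruling l c \<alpha> s = c (t k) + w k *\<^sub>R r2 (t k)"
    proof -
      have "(w k / v k) * (r2 (t k) \<bullet> n s) < 0"
        using that(1) v(1)[of k] elim by (intro mult_neg_pos divide_neg_pos) auto
      then show False using expand[OF that(2), of "n s"] elim by linarith
    qed
    then show ?case using tw[of k] by blast
  qed
  \<comment> \<open>In the normal plane \<open>\<nu>\<close> is orthogonal to the limiting ruling
    \<open>r1 s\<close>. Since \<open>w k / v k\<close> is bounded by 2, the contribution of the
    second image along \<open>\<nu>\<close> disappears in the limit.\<close>
  define \<nu> where "\<nu> = cos (\<alpha>' s) *\<^sub>R b s - sin (\<alpha>' s) *\<^sub>R n s"
  have "r1 s \<bullet> \<nu> = 0"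
    by (simp add: \<nu>_def r1_def inner_diff_right ruling_inner[OF s])
  then have r1\<nu>: "(\<lambda>k. r1 (t k) \<bullet> \<nu>) \<longlonglongrightarrow> 0"
    using tendsto_inner[OF r1 tendsto_const[of \<nu>]] by simp
  have "(\<lambda>k. (w k / v k) * (r1 (t k) \<bullet> \<nu>)) \<longlonglongrightarrow> 0"
  proof (rule Lim_null_comparison)
    show "(\<lambda>k. 2 * \<bar>r1 (t k) \<bullet> \<nu>\<bar>) \<longlonglongrightarrow> 0"
      using tendsto_mult_right_zero[OF tendsto_rabs_zero[OF r1\<nu>], of 2] .
    have "\<bar>w k / v k\<bar> \<le> 2" for k using w[of k] v(1)[of k] by (simp add: field_simps)
    then show "\<forall>\<^sub>F k in sequentially. norm ((w k / v k) * (r1 (t k) \<bullet> \<nu>)) \<le> 2 * \<bar>r1 (t k) \<bullet> \<nu>\<bar>"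
      unfolding real_norm_def abs_mult by (intro always_eventually allI mult_right_mono) auto
  qed
  moreover have "e s \<bullet> \<nu> = 0"
    by (simp add: \<nu>_def inner_diff_right frenet_orthonormal[OF s])
  ultimately have "(\<lambda>k. ((c (t k) - c s) \<bullet> \<nu>) / v k + (w k / v k) * (r1 (t k) \<bullet> \<nu>)) \<longlonglongrightarrow> 0"
    using tendsto_add[OF secant] by force
  moreover have "\<forall>\<^sub>F k in sequentially. ((c (t k) - c s) \<bullet> \<nu>) / v k + (w k / v k) * (r1 (t k) \<bullet> \<nu>) = ruling l c \<alpha> s \<bullet> \<nu>"
    using sheet by eventually_elim (use expand in simp)
  ultimately have "(\<lambda>k::nat. ruling l c \<alpha> s \<bullet> \<nu>) \<longlonglongrightarrow> 0"
    by (rule Lim_transform_eventually)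
  then have "ruling l c \<alpha> s \<bullet> \<nu> = 0" by (simp add: LIMSEQ_const_iff)
  moreover have "ruling l c \<alpha> s \<bullet> \<nu> = sin (beta_ang l c \<alpha> s) * sin (\<alpha> s - \<alpha>' s)"
    by (simp add: \<nu>_def inner_diff_right ruling_inner[OF s] sin_diff algebra_simps)
  ultimately have "sin (\<alpha> s - \<alpha>' s) = 0" using sin_beta_pos[of \<alpha> s] by simp
  then show ?thesis using ang sin_eq_0_pi[of "\<alpha> s - \<alpha>' s"] by (auto simp: abs_less_iff)
qed

section \<open>Congruences of foldings expressed by symmetries of the arc\<close>

definition sym_fixing :: "real \<Rightarrow> bool" where
  "sym_fixing \<delta> \<longleftrightarrow> (\<exists>Q t. orthogonal_matrix Q \<and> det Q = \<delta> \<and> (\<forall>s\<in>J. Q *v c s + t = c s))"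

definition sym_reversing :: "real \<Rightarrow> bool" where
  "sym_reversing \<delta> \<longleftrightarrow> (\<exists>Q t. orthogonal_matrix Q \<and> det Q = \<delta> \<and> (\<forall>s\<in>J. Q *v c s + t = c (- s)))"

lemma origami_image_fixing:
  assumes "orthogonal_matrix Q" "\<forall>s\<in>J. Q *v c s + t = c s" "smooth_on J \<alpha>"
  shows "(\<lambda>x. Q *v x + t) ` origami_image l c \<alpha> \<epsilon> = origami_image l c (\<lambda>s. det Q * \<alpha> s) \<epsilon>"
  unfolding origami_image_affine[OF l_pos arclen assms(1,3)]
  using assms(2) smooth_on_scaleR(2)[OF l_pos assms(3)]
  by (intro origami_image_cong[OF l_pos arclen]) auto

text \<open>The symmetry produces a folding over the reversed parametrization with angle
  \<open>det Q * \<alpha> s\<close>. Reparametrizing by \<open>c\<close> again adds the sign and the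
  reversal of the argument.\<close>

lemma origami_image_reversing:
  assumes "orthogonal_matrix Q" "\<forall>s\<in>J. Q *v c s + t = c (- s)" "smooth_on J \<alpha>"
  shows "(\<lambda>x. Q *v x + t) ` origami_image l c \<alpha> \<epsilon> = origami_image l c (\<lambda>s. - det Q * \<alpha> (- s)) \<epsilon>"
proof -
  have "(\<lambda>x. Q *v x + t) ` origami_image l c \<alpha> \<epsilon> = origami_image l (\<lambda>s. c (- s)) (\<lambda>s. det Q * \<alpha> s) \<epsilon>"
    unfolding origami_image_affine[OF l_pos arclen assms(1,3)]
    using assms(2) smooth_on_scaleR(2)[OF l_pos assms(3)]
    by (intro origami_image_cong[OF l_pos arclen_param_reverse[OF l_pos arclen]]) auto
  also have "\<dots> = origami_image l c (\<lambda>s. - det Q * \<alpha> (- s)) \<epsilon>"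
    using origami_image_reverse[OF l_pos arclen
        smooth_on_scaleR(2)[OF l_pos smooth_on_reverse(2)[OF l_pos assms(3)], of "- det Q"]] by simp
  finally show ?thesis .
qed

text \<open>A congruence maps the intersections of the images onto each other, hence maps the arc to
  itself and fixes or reverses it. The image of the first folding is then a folding over
  \<open>c\<close> with a known angle, which must be \<open>\<alpha>'\<close> because the germ
  determines it.\<close>

lemma germ_congruent_iff:
  assumes \<alpha>: "admissible_angle \<alpha>" and \<alpha>': "admissible_angle \<alpha>'"
  shows "germ_congruent l (c, \<alpha>) (c, \<alpha>') \<longleftrightarrow>
    (\<exists>\<delta>. (sym_fixing \<delta> \<and> (\<forall>s\<in>J. \<alpha>' s = \<delta> * \<alpha> s)) \<or> (sym_reversing \<delta> \<and> (\<forall>s\<in>J. \<alpha>' s = - \<delta> * \<alpha> (- s))))"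
    (is "_ \<longleftrightarrow> (\<exists>\<delta>. ?fix \<delta> \<or> ?rev \<delta>)")
proof
  have sm: "smooth_on J \<alpha>" "smooth_on J \<alpha>'" and rng: "\<And>s. s \<in> J \<Longrightarrow> 0 < \<bar>\<alpha> s\<bar> \<and> \<bar>\<alpha> s\<bar> < pi/2"
    using \<alpha> \<alpha>' by (auto simp: admissible_angle_def)
  {
    assume "germ_congruent l (c, \<alpha>) (c, \<alpha>')"
    then obtain T \<epsilon>0 where T: "isometry T" and \<epsilon>0: "\<epsilon>0 > 0"
      and img: "\<And>\<epsilon>. 0 < \<epsilon> \<Longrightarrow> \<epsilon> < \<epsilon>0 \<Longrightarrow> T ` origami_image l c \<alpha> \<epsilon> = origami_image l c \<alpha>' \<epsilon>"
      by (auto simp: germ_congruent_def)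
    obtain Q t where Q: "orthogonal_matrix Q" and TQ: "T = (\<lambda>x. Q *v x + t)"
      using isometry_affine[OF T] .
    have det: "det Q = 1 \<or> det Q = -1" by (rule det_orthogonal_matrix[OF Q])
    have "T x \<in> origami_image l c \<alpha>' \<epsilon> \<longleftrightarrow> x \<in> origami_image l c \<alpha> \<epsilon>" if "0 < \<epsilon>" "\<epsilon> < \<epsilon>0" for x \<epsilon>
      unfolding img[OF that, symmetric] by (rule inj_image_mem_iff[OF isometry_inj[OF T]])
    then have "T x \<in> c ` J \<longleftrightarrow> x \<in> c ` J" for x
      using origami_image_Inter[OF \<epsilon>0, of x \<alpha>] origami_image_Inter[OF \<epsilon>0, of "T x" \<alpha>'] by blast
    then have "T ` (T -` (c ` J)) = c ` J" "T -` (c ` J) = c ` J"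
      using surj_image_vimage_eq[OF bij_is_surj[OF isometry_bij[OF T]]] by (blast, auto)
    then have "T ` c ` J = c ` J" by simp
    from symmetry_param_cases[OF l_pos arclen Q this[unfolded TQ]]
    have "?fix (det Q) \<or> ?rev (det Q)"
    proof
      assume fixed: "\<forall>s\<in>J. Q *v c s + t = c s"
      have adm: "admissible_angle (\<lambda>s. det Q * \<alpha> s)"
        using smooth_on_scaleR(2)[OF l_pos sm(1), of "det Q"] rng det
        by (auto simp: admissible_angle_def abs_mult)
      have "det Q * \<alpha> s = \<alpha>' s" if "s \<in> J" for s
        using origami_image_fixing[OF Q fixed sm(1)] img TQ
        by (intro origami_germ_determines_angle[OF adm \<alpha>' \<epsilon>0 _ that]) auto
      moreover have "sym_fixing (det Q)" unfolding sym_fixing_def using Q fixed by blast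
      ultimately show ?thesis by auto
    next
      assume rev: "\<forall>s\<in>J. Q *v c s + t = c (- s)"
      have adm: "admissible_angle (\<lambda>s. - det Q * \<alpha> (- s))"
        using smooth_on_scaleR(2)[OF l_pos smooth_on_reverse(2)[OF l_pos sm(1)], of "- det Q"] rng det
        by (auto simp: admissible_angle_def abs_mult)
      have "- det Q * \<alpha> (- s) = \<alpha>' s" if "s \<in> J" for s
        using origami_image_reversing[OF Q rev sm(1)] img TQ
        by (intro origami_germ_determines_angle[OF adm \<alpha>' \<epsilon>0 _ that]) auto
      moreover have "sym_reversing (det Q)" unfolding sym_reversing_def using Q rev by blast
      ultimately show ?thesis by auto
    qed
    then show "\<exists>\<delta>. ?fix \<delta> \<or> ?rev \<delta>" by blast
  }
  assume "\<exists>\<delta>. ?fix \<delta> \<or> ?rev \<delta>"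
  then obtain Q t where Q: "orthogonal_matrix Q" and
    img: "\<And>\<epsilon>. (\<lambda>x. Q *v x + t) ` origami_image l c \<alpha> \<epsilon> = origami_image l c \<alpha>' \<epsilon>"
  proof (elim exE disjE conjE)
    fix \<delta> assume "sym_fixing \<delta>" and eq: "\<forall>s\<in>J. \<alpha>' s = \<delta> * \<alpha> s"
    then obtain Q t where Q: "orthogonal_matrix Q" "det Q = \<delta>" "\<forall>s\<in>J. Q *v c s + t = c s"
      by (auto simp: sym_fixing_def)
    have "origami_image l c (\<lambda>s. det Q * \<alpha> s) \<epsilon> = origami_image l c \<alpha>' \<epsilon>" for \<epsilon>
      using Q(2) eq by (intro origami_image_cong[OF l_pos arclen sm(2)]) auto
    then show thesis using that[OF Q(1), of t] origami_image_fixing[OF Q(1,3) sm(1)] by simp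
  next
    fix \<delta> assume "sym_reversing \<delta>" and eq: "\<forall>s\<in>J. \<alpha>' s = - \<delta> * \<alpha> (- s)"
    then obtain Q t where Q: "orthogonal_matrix Q" "det Q = \<delta>" "\<forall>s\<in>J. Q *v c s + t = c (- s)"
      by (auto simp: sym_reversing_def)
    have "origami_image l c (\<lambda>s. - det Q * \<alpha> (- s)) \<epsilon> = origami_image l c \<alpha>' \<epsilon>" for \<epsilon>
      using Q(2) eq by (intro origami_image_cong[OF l_pos arclen sm(2)]) auto
    then show thesis using that[OF Q(1), of t] origami_image_reversing[OF Q(1,3) sm(1)] by simp
  qed
  then show "germ_congruent l (c, \<alpha>) (c, \<alpha>')"
    unfolding germ_congruent_def
    by (intro exI[of _ "\<lambda>x. Q *v x + t"] exI[of _ 1]) (simp add: affine_isometry)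
qed

end

subsection \<open>Symmetries of the space curve\<close>

lemma affine_neq_id_if_det_neq_1:
  fixes Q :: "real^'n^'n"
  assumes "det Q \<noteq> 1"
  shows "(\<lambda>x. Q *v x + t) \<noteq> id"
proof
  assume id: "(\<lambda>x. Q *v x + t) = id"
  have "t = 0" using fun_cong[OF id, of 0] by simp
  then have "Q *v x = mat 1 *v x" for x using fun_cong[OF id, of x] by simp
  then have "Q = mat 1" by (simp add: matrix_eq)
  then show False using assms by simp
qed

context regular_arc
begin

text \<open>Such a \<open>Q\<close> fixes tangent and normal at 0 and, the determinant being 1, also
  the binormal; these span space.\<close>

lemma fixing_det_1_imp_id:
  assumes Q: "orthogonal_matrix Q" and det: "det Q = 1" and fixed: "\<forall>s\<in>J. Q *v c s + t = c s"
  shows "(\<lambda>x. Q *v x + t) = id"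
proof -
  have 0: "0 \<in> J" using zero_in_Jint[OF l_pos] .
  note F = frenet_affine[OF l_pos arclen Q 0, of t]
  note G = frenet_cong[OF l_pos arclen _ 0, of "\<lambda>s. Q *v c s + t"]
  have fr: "Q *v e 0 = e 0" "Q *v n 0 = n 0" "Q *v b 0 = b 0"
    using F G fixed det by auto
  have "Q *v x = x" for x
  proof -
    \<comment> \<open>The displacement \<open>z\<close> is orthogonal to every vector fixed by
      \<open>Q\<close>. Orthogonality to tangent and normal gives \<open>cross3 z (b 0) = 0\<close>
      by the Lagrange identity; together with orthogonality to \<open>b 0\<close> this forces
      \<open>z = 0\<close>.\<close>
    define z where "z = Q *v x - x"
    have z: "z \<bullet> u = 0" if "Q *v u = u" for u
      using orthogonal_matrix_inner[OF Q, of x u] that by (simp add: z_def inner_diff_left)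
    have "cross3 z (b 0) = 0"
      using z[OF fr(1)] z[OF fr(2)] by (simp add: frenet_b_def Lagrange)
    moreover have "b 0 \<noteq> 0" using frenet_orthonormal(3)[OF 0] by auto
    ultimately have "z = 0" using z[OF fr(3)] norm_and_cross_eq_0[of z "b 0"] by simp
    then show ?thesis by (simp add: z_def)
  qed
  moreover from this have "t = 0" using fixed 0 by (metis add_cancel_right_right)
  ultimately show ?thesis by auto
qed

lemma sym_fixing_1: "sym_fixing 1"
  unfolding sym_fixing_def by (intro exI[of _ "mat 1"] exI[of _ 0]) (simp add: orthogonal_matrix_id)

text \<open>A determinant -1 excludes the identity, so the fixed arc lies in a bisecting plane.
  Conversely, reflection in a plane containing the arc fixes it pointwise.\<close>

lemma sym_fixing_minus_1_iff: "sym_fixing (-1) \<longleftrightarrow> lies_in_plane (c ` J)"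
proof
  assume "sym_fixing (-1)"
  then obtain Q t where Q: "orthogonal_matrix Q" "det Q = -1" "\<forall>s\<in>J. Q *v c s + t = c s"
    by (auto simp: sym_fixing_def)
  have "(\<lambda>x. Q *v x + t) \<noteq> id"
    by (rule affine_neq_id_if_det_neq_1) (simp add: Q(2))
  from isometry_fixing_hyperplane[OF affine_isometry[OF Q(1)] this, of "c ` J"]
  show "lies_in_plane (c ` J)" using Q(3) unfolding lies_in_plane_def by (smt (verit) imageE)
next
  assume "lies_in_plane (c ` J)"
  then obtain u0 d0 where u0: "u0 \<noteq> 0" "\<And>s. s \<in> J \<Longrightarrow> u0 \<bullet> c s = d0"
    by (auto simp: lies_in_plane_def)
  define u where "u = u0 /\<^sub>R norm u0"
  define d where "d = d0 / norm u0"
  have u: "norm u = 1" using u0 by (simp add: u_def)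
  have uc: "u \<bullet> c s = d" if "s \<in> J" for s
    using u0(2)[OF that] by (simp add: u_def d_def divide_inverse)
  \<comment> \<open>Reflection in the plane with unit normal \<open>u\<close> at signed distance
    \<open>d\<close> from the origin. Its determinant is not computed: the value 1 would make it the
    identity by \<open>fixing_det_1_imp_id\<close>.\<close>
  define T where "T x = reflect_dir u x + (2 * d) *\<^sub>R u" for x
  have iso: "isometry T" unfolding T_def by (rule isometry_reflect_dir[OF u])
  obtain Q t where Q: "orthogonal_matrix Q" and TQ: "T = (\<lambda>x. Q *v x + t)"
    using isometry_affine[OF iso] .
  have fixed: "\<forall>s\<in>J. T (c s) = c s"
    by (simp add: T_def reflect_dir_def uc)
  have "T \<noteq> id"
  proof
    assume id: "T = id"
    have "d *\<^sub>R u = 0" using fun_cong[OF id, of 0] by (simp add: T_def reflect_dir_def)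
    moreover have "u \<bullet> u = 1" using u by (simp add: norm_eq_1)
    ultimately have "u - 2 *\<^sub>R u = u"
      using fun_cong[OF id, of u] u by (auto simp: T_def reflect_dir_def)
    then show False using u by auto
  qed
  then have "det Q = -1"
    using det_orthogonal_matrix[OF Q] fixing_det_1_imp_id[OF Q, of t] fixed TQ by blast
  then show "sym_fixing (-1)" unfolding sym_fixing_def using Q fixed TQ by blast
qed

text \<open>Composing with the reflection that fixes the arc changes the determinant but not the
  action on the arc.\<close>

lemma sym_reversing_minus:
  assumes "sym_fixing (-1)" "sym_reversing \<delta>"
  shows "sym_reversing (- \<delta>)"
proof -
  obtain Q t where Q: "orthogonal_matrix Q" "det Q = -1" "\<forall>s\<in>J. Q *v c s + t = c s"
    using assms(1) by (auto simp: sym_fixing_def)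
  obtain Q' t' where Q': "orthogonal_matrix Q'" "det Q' = \<delta>" "\<forall>s\<in>J. Q' *v c s + t' = c (- s)"
    using assms(2) by (auto simp: sym_reversing_def)
  have "(Q ** Q') *v c s + (Q *v t' + t) = c (- s)" if "s \<in> J" for s
  proof -
    have "(Q ** Q') *v c s + (Q *v t' + t) = Q *v (Q' *v c s + t') + t"
      by (simp add: matrix_vector_mul_assoc matrix_vector_right_distrib)
    then show ?thesis using Q(3) Q'(3) that by simp
  qed
  then show ?thesis
    unfolding sym_reversing_def using orthogonal_matrix_mul[OF Q(1) Q'(1)] Q(2) Q'(2)
    by (intro exI[of _ "Q ** Q'"] exI[of _ "Q *v t' + t"]) (simp add: det_mul)
qed

lemma sym_reversing_kappa_even:
  assumes "sym_reversing \<delta>" "s \<in> J"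
  shows "\<kappa> (- s) = \<kappa> s"
proof -
  obtain Q t where Q: "orthogonal_matrix Q" "\<forall>s\<in>J. Q *v c s + t = c (- s)"
    using assms(1) by (auto simp: sym_reversing_def)
  have "\<kappa> s = kappa l (\<lambda>s. Q *v c s + t) s"
    using frenet_affine(1)[OF l_pos arclen Q(1) assms(2)] by simp
  also have "\<dots> = kappa l (\<lambda>s. c (- s)) s"
    using Q(2) assms(2) by (intro frenet_cong(1)[OF l_pos arclen_param_reverse[OF l_pos arclen]]) auto
  also have "\<dots> = \<kappa> (- s)" by (rule frenet_reverse(1)[OF l_pos arclen assms(2)])
  finally show ?thesis by simp
qed

lemma symmetry_cases:
  assumes T: "isometry T" "T ` c ` J = c ` J"
  obtains Q t where "orthogonal_matrix Q" "T = (\<lambda>x. Q *v x + t)" "\<forall>s\<in>J. T (c s) = c s"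
  | Q t where "orthogonal_matrix Q" "T = (\<lambda>x. Q *v x + t)" "\<forall>s\<in>J. T (c s) = c (- s)" "sym_reversing (det Q)"
proof -
  obtain Q t where Q: "orthogonal_matrix Q" and TQ: "T = (\<lambda>x. Q *v x + t)"
    using isometry_affine[OF T(1)] .
  from symmetry_param_cases[OF l_pos arclen Q T(2)[unfolded TQ]] show thesis
  proof
    assume "\<forall>s\<in>J. Q *v c s + t = c s"
    then show thesis using that(1)[OF Q TQ] TQ by simp
  next
    assume rev: "\<forall>s\<in>J. Q *v c s + t = c (- s)"
    then have "sym_reversing (det Q)" unfolding sym_reversing_def using Q by blast
    then show thesis using that(2)[OF Q TQ] TQ rev by simp
  qed
qed

lemma sym_reversing_symmetry:
  assumes "sym_reversing \<delta>"
  obtains Q t where "orthogonal_matrix Q" "det Q = \<delta>" "isometry (\<lambda>x. Q *v x + t)" "(\<lambda>x. Q *v x + t) \<noteq> id"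
    "(\<lambda>x. Q *v x + t) ` c ` J = c ` J" "\<exists>x\<in>c ` J. Q *v x + t \<noteq> x"
proof -
  obtain Q t where Q: "orthogonal_matrix Q" "det Q = \<delta>" and rev: "\<forall>s\<in>J. Q *v c s + t = c (- s)"
    using assms(1) by (auto simp: sym_reversing_def)
  have h: "l/2 \<in> J" by (rule endpoint_in_Jint[OF l_pos])
  then have "c (- (l/2)) \<noteq> c (l/2)"
    using inj_onD[OF inj_c, of "-(l/2)" "l/2"] l_pos by auto
  then have move: "Q *v c (l/2) + t \<noteq> c (l/2)" using rev h by simp
  then have "(\<lambda>x. Q *v x + t) \<noteq> id" by (metis id_apply)
  moreover have "(\<lambda>x. Q *v x + t) ` c ` J = c ` J"
    using rev reverse_image_Jint[of c l] by (simp add: image_image)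
  ultimately show thesis using that[OF Q affine_isometry[OF Q(1)], of t] move h by blast
qed

text \<open>A symmetry that moves a point of the arc must reverse it; conversely a reversal
  exchanges the two distinct endpoints.\<close>

lemma has_nontrivial_symmetry_iff:
  "has_nontrivial_symmetry (c ` J) \<longleftrightarrow> sym_reversing 1 \<or> sym_reversing (-1)"
proof
  assume "has_nontrivial_symmetry (c ` J)"
  then obtain T where T: "isometry T" "T ` c ` J = c ` J" "\<exists>x\<in>c ` J. T x \<noteq> x"
    by (auto simp: has_nontrivial_symmetry_def)
  from T(1,2) show "sym_reversing 1 \<or> sym_reversing (-1)"
    by (cases rule: symmetry_cases) (use T(3) det_orthogonal_matrix in \<open>fastforce, metis\<close>)
next
  assume "sym_reversing 1 \<or> sym_reversing (-1)"
  then obtain \<delta> where "sym_reversing \<delta>" by blast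
  from sym_reversing_symmetry[OF this] show "has_nontrivial_symmetry (c ` J)"
    unfolding has_nontrivial_symmetry_def by metis
qed

lemma has_positive_symmetry_iff: "has_positive_symmetry (c ` J) \<longleftrightarrow> sym_reversing 1"
proof
  assume "has_positive_symmetry (c ` J)"
  then obtain T Q t where T: "isometry T" "T ` c ` J = c ` J" "T \<noteq> id"
    and Q: "orthogonal_matrix Q" "det Q > 0" and "\<And>x. T x = Q *v x + t"
    unfolding has_positive_symmetry_def orientation_preserving_def by blast
  then have TQ: "T = (\<lambda>x. Q *v x + t)" by auto
  have det: "det Q = 1" using det_orthogonal_matrix[OF Q(1)] Q(2) by auto
  from symmetry_param_cases[OF l_pos arclen Q(1) T(2)[unfolded TQ]] show "sym_reversing 1"
  proof
    assume "\<forall>s\<in>J. Q *v c s + t = c s"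
    from fixing_det_1_imp_id[OF Q(1) det this] show ?thesis using T(3) TQ by simp
  next
    assume "\<forall>s\<in>J. Q *v c s + t = c (- s)"
    then show ?thesis unfolding sym_reversing_def using Q(1) det by blast
  qed
next
  assume "sym_reversing 1"
  then obtain Q t where "orthogonal_matrix Q" "det Q = 1" "isometry (\<lambda>x. Q *v x + t)" "(\<lambda>x. Q *v x + t) \<noteq> id"
    "(\<lambda>x. Q *v x + t) ` c ` J = c ` J" by (rule sym_reversing_symmetry)
  moreover from this have "orientation_preserving (\<lambda>x. Q *v x + t)"
    unfolding orientation_preserving_def by (intro exI[of _ Q] exI[of _ t]) simp
  ultimately show "has_positive_symmetry (c ` J)" unfolding has_positive_symmetry_def by blast
qed

lemma has_symmetry_iff:
  "has_symmetry (c ` J) \<longleftrightarrow> sym_fixing (-1) \<or> sym_reversing 1 \<or> sym_reversing (-1)"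
proof
  assume "has_symmetry (c ` J)"
  then obtain T where T: "isometry T" "T ` c ` J = c ` J" "T \<noteq> id"
    by (auto simp: has_symmetry_def)
  from T(1,2) show "sym_fixing (-1) \<or> sym_reversing 1 \<or> sym_reversing (-1)"
  proof (cases rule: symmetry_cases)
    case (1 Q t)
    then have fixed: "\<forall>s\<in>J. Q *v c s + t = c s" by simp
    then have "det Q = -1"
      using fixing_det_1_imp_id[OF 1(1) _ fixed] T(3) 1(2) det_orthogonal_matrix[OF 1(1)] by auto
    then show ?thesis unfolding sym_fixing_def using 1(1) fixed by blast
  next
    case (2 Q t)
    then show ?thesis using det_orthogonal_matrix[OF 2(1)] by auto
  qed
next
  assume "sym_fixing (-1) \<or> sym_reversing 1 \<or> sym_reversing (-1)"
  then consider "sym_fixing (-1)" | "has_nontrivial_symmetry (c ` J)"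
    using has_nontrivial_symmetry_iff by blast
  then show "has_symmetry (c ` J)"
  proof cases
    case 1
    then obtain Q t where Q: "orthogonal_matrix Q" "det Q = -1" "\<forall>s\<in>J. Q *v c s + t = c s"
      by (auto simp: sym_fixing_def)
    have "(\<lambda>x. Q *v x + t) \<noteq> id"
      by (rule affine_neq_id_if_det_neq_1) (simp add: Q(2))
    moreover have "(\<lambda>x. Q *v x + t) ` c ` J = c ` J" using Q(3) by (simp add: image_image)
    ultimately show ?thesis unfolding has_symmetry_def using affine_isometry[OF Q(1)] by blast
  next
    case 2
    then show ?thesis by (auto simp: has_symmetry_def has_nontrivial_symmetry_def)
  qed
qed

text \<open>The determinant is 1 or -1, and fixing with determinant 1 is always possible through the
  identity, so the quantifier over \<open>\<delta>\<close> splits into four explicit cases.\<close>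

lemma germ_congruent_iff_signs:
  assumes "admissible_angle \<alpha>" "admissible_angle \<alpha>'"
  shows "germ_congruent l (c, \<alpha>) (c, \<alpha>') \<longleftrightarrow>
      (\<forall>s\<in>J. \<alpha>' s = \<alpha> s) \<or> (sym_fixing (-1) \<and> (\<forall>s\<in>J. \<alpha>' s = - \<alpha> s))
      \<or> (sym_reversing 1 \<and> (\<forall>s\<in>J. \<alpha>' s = - \<alpha> (- s))) \<or> (sym_reversing (-1) \<and> (\<forall>s\<in>J. \<alpha>' s = \<alpha> (- s)))"
proof -
  have "\<delta> = 1 \<or> \<delta> = -1" if "sym_fixing \<delta> \<or> sym_reversing \<delta>" for \<delta>
    using that det_orthogonal_matrix by (auto simp: sym_fixing_def sym_reversing_def)
  then have ex: "(\<exists>\<delta>. (sym_fixing \<delta> \<and> P \<delta>) \<or> (sym_reversing \<delta> \<and> R \<delta>)) \<longleftrightarrow>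
      P 1 \<or> (sym_fixing (-1) \<and> P (-1)) \<or> (sym_reversing 1 \<and> R 1) \<or> (sym_reversing (-1) \<and> R (-1))" for P R
    using sym_fixing_1 by metis
  show ?thesis
    unfolding germ_congruent_iff[OF assms] ex by simp
qed

text \<open>Evaluation at 0, which reversal leaves fixed, rules out the cases in which a positive
  angle would equal a negative one.\<close>

lemma germ_congruent_same_sign:
  assumes "admissible_angle \<alpha>" "admissible_angle \<alpha>'" "\<And>s. s \<in> J \<Longrightarrow> \<alpha> s > 0" "\<And>s. s \<in> J \<Longrightarrow> \<alpha>' s > 0"
  shows "germ_congruent l (c, \<alpha>) (c, \<alpha>') \<longleftrightarrow>
      (\<forall>s\<in>J. \<alpha>' s = \<alpha> s) \<or> (sym_reversing (-1) \<and> (\<forall>s\<in>J. \<alpha>' s = \<alpha> (- s)))"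
    and "germ_congruent l (c, \<lambda>s. - \<alpha> s) (c, \<lambda>s. - \<alpha>' s) \<longleftrightarrow>
      (\<forall>s\<in>J. \<alpha>' s = \<alpha> s) \<or> (sym_reversing (-1) \<and> (\<forall>s\<in>J. \<alpha>' s = \<alpha> (- s)))"
proof -
  have 0: "0 \<in> J" using zero_in_Jint[OF l_pos] .
  have no: "\<not> (\<forall>s\<in>J. \<alpha>' s = - \<alpha> s)" "\<not> (\<forall>s\<in>J. \<alpha>' s = - \<alpha> (- s))"
    "\<not> (\<forall>s\<in>J. - \<alpha>' s = \<alpha> s)" "\<not> (\<forall>s\<in>J. - \<alpha>' s = \<alpha> (- s))"
    using 0 assms(3)[OF 0] assms(4)[OF 0] by (auto intro!: bexI[of _ 0])
  show "germ_congruent l (c, \<alpha>) (c, \<alpha>') \<longleftrightarrow>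
      (\<forall>s\<in>J. \<alpha>' s = \<alpha> s) \<or> (sym_reversing (-1) \<and> (\<forall>s\<in>J. \<alpha>' s = \<alpha> (- s)))"
    unfolding germ_congruent_iff_signs[OF assms(1,2)] by (simp only: no neg_equal_iff_equal minus_minus simp_thms)
  show "germ_congruent l (c, \<lambda>s. - \<alpha> s) (c, \<lambda>s. - \<alpha>' s) \<longleftrightarrow>
      (\<forall>s\<in>J. \<alpha>' s = \<alpha> s) \<or> (sym_reversing (-1) \<and> (\<forall>s\<in>J. \<alpha>' s = \<alpha> (- s)))"
    unfolding germ_congruent_iff_signs[OF admissible_angle_minus[OF assms(1)] admissible_angle_minus[OF assms(2)]]
    by (simp only: no neg_equal_iff_equal minus_minus simp_thms)
qed

lemma germ_congruent_opposite_sign: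
  assumes "admissible_angle \<alpha>" "admissible_angle \<alpha>'" "\<And>s. s \<in> J \<Longrightarrow> \<alpha> s > 0" "\<And>s. s \<in> J \<Longrightarrow> \<alpha>' s > 0"
  shows "germ_congruent l (c, \<alpha>) (c, \<lambda>s. - \<alpha>' s) \<longleftrightarrow>
      (sym_fixing (-1) \<and> (\<forall>s\<in>J. \<alpha>' s = \<alpha> s)) \<or> (sym_reversing 1 \<and> (\<forall>s\<in>J. \<alpha>' s = \<alpha> (- s)))"
    and "germ_congruent l (c, \<lambda>s. - \<alpha> s) (c, \<alpha>') \<longleftrightarrow>
      (sym_fixing (-1) \<and> (\<forall>s\<in>J. \<alpha>' s = \<alpha> s)) \<or> (sym_reversing 1 \<and> (\<forall>s\<in>J. \<alpha>' s = \<alpha> (- s)))"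
proof -
  have 0: "0 \<in> J" using zero_in_Jint[OF l_pos] .
  have no: "\<not> (\<forall>s\<in>J. \<alpha>' s = - \<alpha> s)" "\<not> (\<forall>s\<in>J. \<alpha>' s = - \<alpha> (- s))"
    "\<not> (\<forall>s\<in>J. - \<alpha>' s = \<alpha> s)" "\<not> (\<forall>s\<in>J. - \<alpha>' s = \<alpha> (- s))"
    using 0 assms(3)[OF 0] assms(4)[OF 0] by (auto intro!: bexI[of _ 0])
  show "germ_congruent l (c, \<alpha>) (c, \<lambda>s. - \<alpha>' s) \<longleftrightarrow>
      (sym_fixing (-1) \<and> (\<forall>s\<in>J. \<alpha>' s = \<alpha> s)) \<or> (sym_reversing 1 \<and> (\<forall>s\<in>J. \<alpha>' s = \<alpha> (- s)))"
    unfolding germ_congruent_iff_signs[OF assms(1) admissible_angle_minus[OF assms(2)]] by (simp only: no neg_equal_iff_equal minus_minus simp_thms)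
  show "germ_congruent l (c, \<lambda>s. - \<alpha> s) (c, \<alpha>') \<longleftrightarrow>
      (sym_fixing (-1) \<and> (\<forall>s\<in>J. \<alpha>' s = \<alpha> s)) \<or> (sym_reversing 1 \<and> (\<forall>s\<in>J. \<alpha>' s = \<alpha> (- s)))"
    unfolding germ_congruent_iff_signs[OF admissible_angle_minus[OF assms(1)] assms(2)]
    by (simp only: no neg_equal_iff_equal minus_minus simp_thms)
qed

end

subsection \<open>Representatives of the congruence classes\<close>

text \<open>Both endpoints must be sent into the interval, which forces the shift \<open>d\<close>
  to be 0; only identity and reversal remain.\<close>

lemma equi_affine_equiv_iff:
  assumes l: "l > 0"
  shows "equi_affine_equiv l \<mu>1 \<mu>2 \<longleftrightarrow>
    (\<forall>s\<in>Jint l. \<mu>2 s = \<mu>1 s) \<or> (\<forall>s\<in>Jint l. \<mu>2 s = \<mu>1 (- s))"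
proof
  assume "equi_affine_equiv l \<mu>1 \<mu>2"
  then obtain \<sigma> d where \<sigma>: "\<sigma> = 1 \<or> \<sigma> = -1"
    and eq: "\<And>s. s \<in> Jint l \<Longrightarrow> \<sigma> * s + d \<in> Jint l \<and> \<mu>2 (\<sigma> * s + d) = \<mu>1 s"
    unfolding equi_affine_equiv_def by blast
  have "l/2 \<in> Jint l" "-(l/2) \<in> Jint l" using l by (auto simp: Jint_def)
  from eq[OF this(1)] eq[OF this(2)] have d: "d = 0" using \<sigma> by (auto simp: Jint_def)
  from \<sigma> show "(\<forall>s\<in>Jint l. \<mu>2 s = \<mu>1 s) \<or> (\<forall>s\<in>Jint l. \<mu>2 s = \<mu>1 (- s))"
  proof
    assume "\<sigma> = -1"
    then have "\<mu>2 s = \<mu>1 (- s)" if "s \<in> Jint l" for s using eq[of "- s"] d that by simp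
    then show ?thesis by blast
  qed (use eq d in auto)
next
  assume "(\<forall>s\<in>Jint l. \<mu>2 s = \<mu>1 s) \<or> (\<forall>s\<in>Jint l. \<mu>2 s = \<mu>1 (- s))"
  then show "equi_affine_equiv l \<mu>1 \<mu>2"
  proof
    assume "\<forall>s\<in>Jint l. \<mu>2 s = \<mu>1 s"
    then show ?thesis unfolding equi_affine_equiv_def by (intro exI[of _ 1] exI[of _ 0]) simp
  next
    assume "\<forall>s\<in>Jint l. \<mu>2 s = \<mu>1 (- s)"
    then show ?thesis unfolding equi_affine_equiv_def by (intro exI[of _ "-1"] exI[of _ 0]) simp
  qed
qed

lemma germ_congruent_equiv:
  "equiv A {(F, G). F \<in> A \<and> G \<in> A \<and> germ_congruent l F G}"
proof (rule equivI)
  have refl: "germ_congruent l F F" for F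
    unfolding germ_congruent_def by (intro exI[of _ id] exI[of _ 1]) (simp add: isometry_id)
  then show "refl_on A {(F, G). F \<in> A \<and> G \<in> A \<and> germ_congruent l F G}"
    by (auto simp: refl_on_def)
  have sym: "germ_congruent l G F" if "germ_congruent l F G" for F G
  proof -
    obtain T \<epsilon>0 where T: "isometry T" "\<epsilon>0 > 0" "\<And>\<epsilon>. 0 < \<epsilon> \<Longrightarrow> \<epsilon> < \<epsilon>0 \<Longrightarrow>
        T ` origami_image l (fst F) (snd F) \<epsilon> = origami_image l (fst G) (snd G) \<epsilon>"
      using \<open>germ_congruent l F G\<close> unfolding germ_congruent_def by blast
    have "inv T ` T ` B = B" for B using isometry_inj[OF T(1)] by (simp add: image_comp)
    then have "inv T ` origami_image l (fst G) (snd G) \<epsilon> = origami_image l (fst F) (snd F) \<epsilon>"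
      if "0 < \<epsilon>" "\<epsilon> < \<epsilon>0" for \<epsilon> using T(3)[OF that] by metis
    then show ?thesis unfolding germ_congruent_def using isometry_inv[OF T(1)] T(2) by blast
  qed
  then show "sym {(F, G). F \<in> A \<and> G \<in> A \<and> germ_congruent l F G}" by (auto simp: sym_def)
  have trans: "germ_congruent l F H" if FG: "germ_congruent l F G" and GH: "germ_congruent l G H" for F G H
  proof -
    obtain T \<epsilon>0 where T: "isometry T" "\<epsilon>0 > 0" "\<And>\<epsilon>. 0 < \<epsilon> \<Longrightarrow> \<epsilon> < \<epsilon>0 \<Longrightarrow>
        T ` origami_image l (fst F) (snd F) \<epsilon> = origami_image l (fst G) (snd G) \<epsilon>"
      using FG unfolding germ_congruent_def by blast
    obtain U \<epsilon>1 where U: "isometry U" "\<epsilon>1 > 0" "\<And>\<epsilon>. 0 < \<epsilon> \<Longrightarrow> \<epsilon> < \<epsilon>1 \<Longrightarrow>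
        U ` origami_image l (fst G) (snd G) \<epsilon> = origami_image l (fst H) (snd H) \<epsilon>"
      using GH unfolding germ_congruent_def by blast
    have "(U \<circ> T) ` origami_image l (fst F) (snd F) \<epsilon> = origami_image l (fst H) (snd H) \<epsilon>"
      if "0 < \<epsilon>" "\<epsilon> < min \<epsilon>0 \<epsilon>1" for \<epsilon>
      unfolding image_comp[symmetric] using T(3)[of \<epsilon>] U(3)[of \<epsilon>] that by simp
    then show ?thesis unfolding germ_congruent_def
      using isometry_comp[OF U(1) T(1)] T(2) U(2) by (intro exI[of _ "U \<circ> T"] exI[of _ "min \<epsilon>0 \<epsilon>1"]) auto
  qed
  then show "trans {(F, G). F \<in> A \<and> G \<in> A \<and> germ_congruent l F G}" by (auto intro!: transI)
qed auto

lemma germ_congruent_if_image_eq: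
  assumes "\<And>\<epsilon>. origami_image l c \<alpha> \<epsilon> = origami_image l c' \<alpha>' \<epsilon>"
  shows "germ_congruent l (c, \<alpha>) (c', \<alpha>')"
  unfolding germ_congruent_def using assms
  by (intro exI[of _ id] exI[of _ 1]) (simp add: isometry_id)

context regular_arc
begin

text \<open>For \<open>0 < \<mu> < \<kappa>\<close> this is the positive angle with
  \<open>\<kappa> cos \<alpha> = \<mu>\<close>; its negative gives the dual.\<close>

definition fold_angle :: "(real \<Rightarrow> real) \<Rightarrow> real \<Rightarrow> real" where
  "fold_angle \<mu> s = arccos (\<mu> s / \<kappa> s)"

lemma smooth_kappa: "smooth_on J \<kappa>"
  unfolding kappa_def[abs_def]
  by (rule smooth_on_norm[OF l_pos smooth_on_nderiv[OF l_pos smooth_c] nonzero_curv])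

lemma fold_angle_range:
  assumes "0 < \<mu> s" "\<mu> s < \<kappa> s"
  shows "0 < fold_angle \<mu> s" "fold_angle \<mu> s < pi/2" "\<kappa> s * cos (fold_angle \<mu> s) = \<mu> s"
proof -
  have q: "0 < \<mu> s / \<kappa> s" "\<mu> s / \<kappa> s < 1" using assms by auto
  show "0 < fold_angle \<mu> s"
    unfolding fold_angle_def using arccos_lt_bounded[of "\<mu> s / \<kappa> s"] q by linarith
  show "fold_angle \<mu> s < pi/2"
    unfolding fold_angle_def using arccos_less_arccos[of 0 "\<mu> s / \<kappa> s"] q by simp
  show "\<kappa> s * cos (fold_angle \<mu> s) = \<mu> s"
  proof -
    have "cos (arccos (\<mu> s / \<kappa> s)) = \<mu> s / \<kappa> s" using q by (intro cos_arccos) linarith+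
    then show ?thesis using assms by (simp add: fold_angle_def)
  qed
qed

lemma admissible_fold_angle:
  assumes \<mu>: "smooth_on J \<mu>" "\<And>s. s \<in> J \<Longrightarrow> 0 < \<mu> s" "\<And>s. s \<in> J \<Longrightarrow> \<mu> s < \<kappa> s"
  shows "admissible_angle (fold_angle \<mu>)"
proof -
  have "Ck_on k J (fold_angle \<mu>)" for k
    unfolding fold_angle_def[abs_def] divide_inverse
    using \<mu>(1) smooth_kappa unfolding smooth_on_iff_Ck_on[OF l_pos]
  proof (intro Ck_on_arccos Ck_on_mult Ck_on_inverse)
    show "\<kappa> s \<noteq> 0" if "s \<in> J" for s using kappa_pos[OF that] by simp
    show "\<bar>\<mu> s * inverse (\<kappa> s)\<bar> < 1" if "s \<in> J" for s
      using \<mu>(2,3)[OF that] by (simp add: divide_inverse[symmetric] abs_mult)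
  qed auto
  then have "smooth_on J (fold_angle \<mu>)" by (simp add: smooth_on_iff_Ck_on[OF l_pos])
  moreover have "0 < \<bar>fold_angle \<mu> s\<bar> \<and> \<bar>fold_angle \<mu> s\<bar> < pi/2" if "s \<in> J" for s
    using fold_angle_range[of \<mu> s] \<mu>(2,3)[OF that] by simp
  ultimately show ?thesis by (simp add: admissible_angle_def)
qed

text \<open>The cosine determines the absolute value of the angle; a continuous angle without zeros
  has one sign on the whole interval.\<close>

lemma angle_eq_fold_angle:
  assumes \<alpha>: "admissible_angle \<alpha>" and eq: "\<And>s. s \<in> J \<Longrightarrow> \<kappa> s * cos (\<alpha> s) = \<mu> s"
  shows "(\<forall>s\<in>J. \<alpha> s = fold_angle \<mu> s) \<or> (\<forall>s\<in>J. \<alpha> s = - fold_angle \<mu> s)"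
proof -
  have abs: "\<bar>\<alpha> s\<bar> = fold_angle \<mu> s" if "s \<in> J" for s
  proof -
    have "\<mu> s / \<kappa> s = cos \<bar>\<alpha> s\<bar>" using eq[OF that] kappa_pos[OF that] by (simp add: field_simps)
    moreover have "\<bar>\<alpha> s\<bar> \<le> pi"
      using \<alpha> that pi_gt_zero by (fastforce simp: admissible_angle_def)
    ultimately show ?thesis by (simp only: fold_angle_def arccos_cos abs_ge_zero)
  qed
  have "smooth_on J \<alpha>" "\<And>s. s \<in> J \<Longrightarrow> \<alpha> s \<noteq> 0" using \<alpha> by (auto simp: admissible_angle_def)
  from continuous_nonzero_sign[OF smooth_on_continuous[OF this(1)] this(2)] show ?thesis
    using abs by (metis abs_of_neg abs_of_pos minus_minus)
qed

lemma kappa_reparam: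
  assumes "arclen_param l c'" "c' ` J = c ` J"
  obtains "\<And>s. s \<in> J \<Longrightarrow> c' s = c s" "\<And>s. s \<in> J \<Longrightarrow> kappa l c' s = \<kappa> s"
  | "\<And>s. s \<in> J \<Longrightarrow> c' s = c (- s)" "\<And>s. s \<in> J \<Longrightarrow> kappa l c' s = \<kappa> (- s)"
proof -
  from arclen_param_unique[OF l_pos arclen assms] show thesis
  proof
    assume "\<forall>s\<in>J. c' s = c s"
    then show thesis using that(1) frenet_cong(1)[OF l_pos arclen, of c'] by blast
  next
    assume "\<forall>s\<in>J. c' s = c (- s)"
    then show thesis
      using that(2) frenet_cong(1)[OF l_pos arclen_param_reverse[OF l_pos arclen], of c']
        frenet_reverse(1)[OF l_pos arclen] by simp
  qed
qed

lemma INF_kappa_reparam: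
  assumes "arclen_param l c'" "c' ` J = c ` J"
  shows "(INF w\<in>J. kappa l c' w) = (INF w\<in>J. \<kappa> w)"
  using assms
proof (cases rule: kappa_reparam)
  case 1
  then show ?thesis by (simp cong: image_cong)
next
  case 2
  then have "kappa l c' ` J = (\<lambda>s. \<kappa> (- s)) ` J" by (intro image_cong) auto
  then show ?thesis using reverse_image_Jint[of \<kappa> l] by simp
qed

text \<open>Both parametrizations of the arc have the same infimum of curvature, so the bound can be
  stated with the fixed \<open>c\<close> although \<open>c'\<close> may run backwards.\<close>

lemma P_star_iff:
  "(c', \<alpha>) \<in> P_star l \<gamma> (c ` J) \<longleftrightarrow>
     arclen_param l c' \<and> c' ` J = c ` J \<and> admissible_angle \<alpha>
     \<and> (\<forall>s\<in>J. kappa l c' s * cos (\<alpha> s) < (INF w\<in>J. \<kappa> w))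
     \<and> ((\<forall>s\<in>J. kappa l c' s * cos (\<alpha> s) = plane_curv l \<gamma> s)
        \<or> (\<forall>s\<in>J. kappa l c' s * cos (\<alpha> s) = plane_curv l \<gamma> (- s)))"
  unfolding P_star_def admissible_nf_def is_generator_def equi_affine_equiv_iff[OF l_pos] mu_nf_def
    admissible_angle_def
  using INF_kappa_reparam by auto

lemma P_starE:
  assumes "(c', \<alpha>) \<in> P_star l \<gamma> (c ` J)"
  obtains \<mu> where "arclen_param l c'" "c' ` J = c ` J" "admissible_angle \<alpha>"
    "\<forall>s\<in>J. \<mu> s < (INF w\<in>J. \<kappa> w)"
    "\<mu> = plane_curv l \<gamma> \<or> \<mu> = (\<lambda>s. plane_curv l \<gamma> (- s))"
    "\<forall>s\<in>J. kappa l c' s * cos (\<alpha> s) = \<mu> s"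
proof -
  note F = assms[unfolded P_star_iff]
  have "\<exists>\<mu>. (\<mu> = plane_curv l \<gamma> \<or> \<mu> = (\<lambda>s. plane_curv l \<gamma> (- s))) \<and> (\<forall>s\<in>J. kappa l c' s * cos (\<alpha> s) = \<mu> s)"
    using F by blast
  then obtain \<mu> where \<mu>: "\<mu> = plane_curv l \<gamma> \<or> \<mu> = (\<lambda>s. plane_curv l \<gamma> (- s))"
    "\<And>s. s \<in> J \<Longrightarrow> kappa l c' s * cos (\<alpha> s) = \<mu> s" by blast
  have "\<mu> s < (INF w\<in>J. \<kappa> w)" if "s \<in> J" for s
    using F that unfolding \<mu>(2)[OF that, symmetric] by blast
  then show thesis using F \<mu> by (intro that[of \<mu>]) simp_all
qed

end

section \<open>The four angles compatible with the crease pattern\<close>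

locale crease_data = regular_arc +
  fixes \<gamma> :: "real \<Rightarrow> real^2"
  assumes arclen_\<gamma>: "arclen_param l \<gamma>" and nonempty: "P_star l \<gamma> (c ` J) \<noteq> {}"
begin

abbreviation "m \<equiv> plane_curv l \<gamma>"

text \<open>Nonemptiness enters here: one existing folding has positive
  \<open>\<kappa> cos \<alpha>\<close> below the infimum, and this function is \<open>m\<close> or
  its reversal.\<close>

lemma m_pos_less_INF:
  assumes s: "s \<in> J"
  shows "0 < m s" "m s < (INF w\<in>J. \<kappa> w)"
proof -
  obtain c' \<alpha> where "(c', \<alpha>) \<in> P_star l \<gamma> (c ` J)" using nonempty by auto
  then obtain \<mu> where c': "arclen_param l c'" "c' ` J = c ` J" and \<alpha>: "admissible_angle \<alpha>"
    and less: "\<forall>s\<in>J. \<mu> s < (INF w\<in>J. \<kappa> w)"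
    and \<mu>: "\<mu> = m \<or> \<mu> = (\<lambda>s. m (- s))"
    and eq: "\<forall>s\<in>J. kappa l c' s * cos (\<alpha> s) = \<mu> s"
    by (rule P_starE) (rule that)
  have pos: "\<mu> s > 0" if s: "s \<in> J" for s
  proof -
    from c' have "kappa l c' s > 0"
    proof (cases rule: kappa_reparam)
      case 1
      then show ?thesis using kappa_pos[OF s] s by simp
    next
      case 2
      then show ?thesis using kappa_pos[of "- s"] s by simp
    qed
    moreover have "cos (\<alpha> s) > 0"
      using \<alpha> s by (intro cos_gt_zero_pi) (auto simp: admissible_angle_def abs_less_iff)
    ultimately show ?thesis using eq s by (metis mult_pos_pos)
  qed
  from \<mu> show "0 < m s" using pos[OF s] pos[of "- s"] s by auto
  from \<mu> show "m s < (INF w\<in>J. \<kappa> w)" using bspec[OF less s] bspec[OF less, of "- s"] s by auto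
qed

text \<open>The two points are independent, which makes both \<open>m s / \<kappa> s\<close> and
  \<open>m (- s) / \<kappa> s\<close> less than 1. Hence both \<open>a0\<close> and
  \<open>a1\<close> are genuine angles.\<close>

lemma m_less_kappa:
  assumes "s \<in> J" "t \<in> J"
  shows "m s < \<kappa> t"
proof -
  have "(INF w\<in>J. \<kappa> w) \<le> \<kappa> t"
    using kappa_pos by (intro cINF_lower assms bdd_belowI2[of _ 0]) (auto intro: less_imp_le)
  then show ?thesis using m_pos_less_INF(2)[OF assms(1)] by simp
qed

lemma smooth_m: "smooth_on J m"
  unfolding plane_curv_def[abs_def]
proof (rule smooth_on_norm[OF l_pos smooth_on_nderiv[OF l_pos arclen_paramD(1)[OF arclen_\<gamma>]]])
  show "nderiv 2 \<gamma> J s \<noteq> 0" if "s \<in> J" for s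
    using m_pos_less_INF(1)[OF that] by (auto simp: plane_curv_def)
qed

definition "a0 = fold_angle m"
definition "a1 = fold_angle (\<lambda>s. m (- s))"

lemma a0_a1_range:
  assumes "s \<in> J"
  shows "0 < a0 s" "0 < a1 s" "\<kappa> s * cos (a0 s) = m s" "\<kappa> s * cos (a1 s) = m (- s)"
  using fold_angle_range[of m s] fold_angle_range[of "\<lambda>s. m (- s)" s]
    m_pos_less_INF(1)[of s] m_pos_less_INF(1)[of "- s"] m_less_kappa[of s s] m_less_kappa[of "- s" s] assms
  by (auto simp: a0_def a1_def)

lemma admissible_a0_a1: "admissible_angle a0" "admissible_angle a1"
  unfolding a0_def a1_def
  using smooth_m smooth_on_reverse(2)[OF l_pos smooth_m] m_pos_less_INF(1) m_less_kappa
  by (auto intro!: admissible_fold_angle)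

lemma mem_P_starI:
  assumes "\<alpha> = a0 \<or> \<alpha> = a1"
  shows "(c, \<alpha>) \<in> P_star l \<gamma> (c ` J)" "(c, \<lambda>s. - \<alpha> s) \<in> P_star l \<gamma> (c ` J)"
proof -
  have "admissible_angle \<alpha>" using assms admissible_a0_a1 by blast
  moreover from this have "admissible_angle (\<lambda>s. - \<alpha> s)" by (rule admissible_angle_minus)
  moreover have "(\<forall>s\<in>J. \<kappa> s * cos (\<alpha> s) = m s) \<or> (\<forall>s\<in>J. \<kappa> s * cos (\<alpha> s) = m (- s))"
    using assms a0_a1_range(3,4) by blast
  moreover from this have "\<forall>s\<in>J. \<kappa> s * cos (\<alpha> s) < (INF w\<in>J. \<kappa> w)"
    using m_pos_less_INF(2) by (metis uminus_Jint_iff)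
  ultimately show "(c, \<alpha>) \<in> P_star l \<gamma> (c ` J)" "(c, \<lambda>s. - \<alpha> s) \<in> P_star l \<gamma> (c ` J)"
    unfolding P_star_iff cos_minus using arclen by blast+
qed

text \<open>First \<open>c'\<close> is replaced by \<open>c\<close> without changing the images,
  negating and reversing the angle if necessary. The new angle has \<open>\<kappa> cos\<close> equal
  to \<open>m\<close> or its reversal, so it is plus or minus \<open>a0\<close> or
  \<open>a1\<close>.\<close>

lemma P_star_reduce:
  assumes F: "(c', \<alpha>) \<in> P_star l \<gamma> (c ` J)"
  obtains \<alpha>' where "\<alpha>' \<in> {a0, a1}"
    "germ_congruent l (c', \<alpha>) (c, \<alpha>') \<or> germ_congruent l (c', \<alpha>) (c, \<lambda>s. - \<alpha>' s)"
proof -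
  obtain \<mu> where c': "arclen_param l c'" "c' ` J = c ` J" and adm: "admissible_angle \<alpha>"
    and \<mu>: "\<mu> = m \<or> \<mu> = (\<lambda>s. m (- s))"
    and eq: "\<forall>s\<in>J. kappa l c' s * cos (\<alpha> s) = \<mu> s"
    using F by (rule P_starE) blast
  have \<alpha>: "smooth_on J \<alpha>" "\<And>s. s \<in> J \<Longrightarrow> 0 < \<bar>\<alpha> s\<bar> \<and> \<bar>\<alpha> s\<bar> < pi/2"
    using adm by (auto simp: admissible_angle_def)
  obtain \<alpha>'' \<mu>' where \<alpha>'': "admissible_angle \<alpha>''" "\<And>s. s \<in> J \<Longrightarrow> \<kappa> s * cos (\<alpha>'' s) = \<mu>' s"
    and \<mu>': "\<mu>' = m \<or> \<mu>' = (\<lambda>s. m (- s))"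
    and img: "\<And>\<epsilon>. origami_image l c' \<alpha> \<epsilon> = origami_image l c \<alpha>'' \<epsilon>"
    using c'
  proof (cases rule: kappa_reparam)
    case 1
    then show thesis
      using eq origami_image_cong[OF l_pos arclen \<alpha>(1), of c' \<alpha>] by (intro that[OF adm _ \<mu>]) auto
  next
    case 2
    have adm': "admissible_angle (\<lambda>s. - \<alpha> (- s))"
      using \<alpha> smooth_on_minus(2)[OF l_pos smooth_on_reverse(2)[OF l_pos \<alpha>(1)]] by (auto simp: admissible_angle_def)
    have "origami_image l c' \<alpha> \<epsilon> = origami_image l c (\<lambda>s. - \<alpha> (- s)) \<epsilon>" for \<epsilon>
    proof -
      have "origami_image l c' \<alpha> \<epsilon> = origami_image l (\<lambda>s. c (- s)) \<alpha> \<epsilon>"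
        using 2(1) by (intro origami_image_cong[OF l_pos arclen_param_reverse[OF l_pos arclen] \<alpha>(1)]) auto
      also have "\<dots> = origami_image l c (\<lambda>s. - \<alpha> (- s)) \<epsilon>"
        using origami_image_reverse[OF l_pos arclen, of "\<lambda>s. - \<alpha> (- s)" \<epsilon>] adm' by (simp add: admissible_angle_def)
      finally show ?thesis .
    qed
    moreover have "\<kappa> s * cos (- \<alpha> (- s)) = \<mu> (- s)" if "s \<in> J" for s
      using 2(2)[of "- s"] bspec[OF eq, of "- s"] that by simp
    moreover have "(\<lambda>s. \<mu> (- s)) = m \<or> (\<lambda>s. \<mu> (- s)) = (\<lambda>s. m (- s))"
      using \<mu> by auto
    ultimately show thesis using adm' by (intro that[of "\<lambda>s. - \<alpha> (- s)" "\<lambda>s. \<mu> (- s)"]) simp_all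
  qed
  define \<alpha>' where "\<alpha>' = fold_angle \<mu>'"
  have \<alpha>': "\<alpha>' \<in> {a0, a1}" "(\<forall>s\<in>J. \<alpha>'' s = \<alpha>' s) \<or> (\<forall>s\<in>J. \<alpha>'' s = - \<alpha>' s)"
    using \<mu>' angle_eq_fold_angle[OF \<alpha>''] unfolding a0_def a1_def \<alpha>'_def by auto
  have sm: "smooth_on J \<alpha>'" "smooth_on J (\<lambda>s. - \<alpha>' s)"
    using \<alpha>'(1) admissible_a0_a1 smooth_on_minus(2)[OF l_pos] by (auto simp: admissible_angle_def)
  from \<alpha>'(2) show thesis
  proof
    assume "\<forall>s\<in>J. \<alpha>'' s = \<alpha>' s"
    then have "origami_image l c' \<alpha> \<epsilon> = origami_image l c \<alpha>' \<epsilon>" for \<epsilon>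
      unfolding img by (intro origami_image_cong[OF l_pos arclen sm(1)]) auto
    then show thesis using that[OF \<alpha>'(1)] germ_congruent_if_image_eq by blast
  next
    assume "\<forall>s\<in>J. \<alpha>'' s = - \<alpha>' s"
    then have "origami_image l c' \<alpha> \<epsilon> = origami_image l c (\<lambda>s. - \<alpha>' s) \<epsilon>" for \<epsilon>
      unfolding img by (intro origami_image_cong[OF l_pos arclen sm(2)]) auto
    then show thesis using that[OF \<alpha>'(1)] germ_congruent_if_image_eq by blast
  qed
qed

lemma symmetric_crease_iff: "has_symmetry (\<gamma> ` J) \<longleftrightarrow> (\<forall>s\<in>J. m (- s) = m s)"
proof -
  have "m s \<noteq> 0" if "s \<in> J" for s using m_pos_less_INF(1)[OF that] by simp
  then show ?thesis
    using plane_curve_symmetric_if_curvature_even[OF l_pos arclen_\<gamma>]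
      curvature_even_if_plane_curve_symmetric[OF l_pos arclen_\<gamma>] by blast
qed

lemma a0_eq_a1_iff: "(\<forall>s\<in>J. a1 s = a0 s) \<longleftrightarrow> has_symmetry (\<gamma> ` J)"
  unfolding symmetric_crease_iff
proof
  assume eq: "\<forall>s\<in>J. a1 s = a0 s"
  show "\<forall>s\<in>J. m (- s) = m s"
  proof
    fix s assume "s \<in> J"
    then show "m (- s) = m s" using a0_a1_range(3,4)[of s] eq by simp
  qed
qed (simp add: a0_def a1_def fold_angle_def)

text \<open>A reversing symmetry makes the curvature even, so reversing the argument only exchanges
  \<open>m s\<close> and \<open>m (- s)\<close> in the arccos.\<close>

lemma a0_a1_reverse:
  assumes "sym_reversing \<delta>" "s \<in> J"
  shows "a0 (- s) = a1 s" "a1 (- s) = a0 s"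
  using sym_reversing_kappa_even[OF assms] by (simp_all add: a0_def a1_def fold_angle_def)

lemma congruent_representatives:
  defines "E \<equiv> has_symmetry (\<gamma> ` J)"
  shows "germ_congruent l (c, a0) (c, \<lambda>s. - a0 s) \<longleftrightarrow> sym_fixing (-1) \<or> (sym_reversing 1 \<and> E)"
    and "germ_congruent l (c, a1) (c, \<lambda>s. - a1 s) \<longleftrightarrow> sym_fixing (-1) \<or> (sym_reversing 1 \<and> E)"
    and "germ_congruent l (c, a0) (c, a1) \<longleftrightarrow> E \<or> sym_reversing (-1)"
    and "germ_congruent l (c, \<lambda>s. - a0 s) (c, \<lambda>s. - a1 s) \<longleftrightarrow> E \<or> sym_reversing (-1)"
    and "germ_congruent l (c, a0) (c, \<lambda>s. - a1 s) \<longleftrightarrow> (sym_fixing (-1) \<and> E) \<or> sym_reversing 1"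
    and "germ_congruent l (c, \<lambda>s. - a0 s) (c, a1) \<longleftrightarrow> (sym_fixing (-1) \<and> E) \<or> sym_reversing 1"
proof -
  have E: "(\<forall>s\<in>J. a1 s = a0 s) \<longleftrightarrow> E" "(\<forall>s\<in>J. a0 s = a1 s) \<longleftrightarrow> E"
    using a0_eq_a1_iff unfolding E_def by auto
  \<comment> \<open>Under a reversing symmetry the condition relating \<open>a1\<close> to the
    reversed \<open>a0\<close> holds automatically, while evenness of \<open>a0\<close> or
    \<open>a1\<close> amounts to \<open>a0 = a1\<close>, that is, to symmetry of the crease
    pattern.\<close>
  have rev: "sym_reversing \<delta> \<and> (\<forall>s\<in>J. a1 s = a0 (- s)) \<longleftrightarrow> sym_reversing \<delta>"
    "sym_reversing \<delta> \<and> (\<forall>s\<in>J. a0 s = a0 (- s)) \<longleftrightarrow> sym_reversing \<delta> \<and> E"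
    "sym_reversing \<delta> \<and> (\<forall>s\<in>J. a1 s = a1 (- s)) \<longleftrightarrow> sym_reversing \<delta> \<and> E" for \<delta>
    using a0_a1_reverse E by auto
  note adm = admissible_a0_a1 and pos = a0_a1_range(1,2)
  show "germ_congruent l (c, a0) (c, \<lambda>s. - a0 s) \<longleftrightarrow> sym_fixing (-1) \<or> (sym_reversing 1 \<and> E)"
    by (subst germ_congruent_opposite_sign(1)[OF adm(1,1) pos(1,1)]) (simp_all only: rev E ball_triv simp_thms)
  show "germ_congruent l (c, a1) (c, \<lambda>s. - a1 s) \<longleftrightarrow> sym_fixing (-1) \<or> (sym_reversing 1 \<and> E)"
    by (subst germ_congruent_opposite_sign(1)[OF adm(2,2) pos(2,2)]) (simp_all only: rev E ball_triv simp_thms)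
  show "germ_congruent l (c, a0) (c, a1) \<longleftrightarrow> E \<or> sym_reversing (-1)"
    by (subst germ_congruent_same_sign(1)[OF adm pos]) (simp_all only: rev E ball_triv simp_thms)
  show "germ_congruent l (c, \<lambda>s. - a0 s) (c, \<lambda>s. - a1 s) \<longleftrightarrow> E \<or> sym_reversing (-1)"
    by (subst germ_congruent_same_sign(2)[OF adm pos]) (simp_all only: rev E ball_triv simp_thms)
  show "germ_congruent l (c, a0) (c, \<lambda>s. - a1 s) \<longleftrightarrow> (sym_fixing (-1) \<and> E) \<or> sym_reversing 1"
    by (subst germ_congruent_opposite_sign(1)[OF adm pos]) (simp_all only: rev E ball_triv simp_thms)
  show "germ_congruent l (c, \<lambda>s. - a0 s) (c, a1) \<longleftrightarrow> (sym_fixing (-1) \<and> E) \<or> sym_reversing 1"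
    by (subst germ_congruent_opposite_sign(2)[OF adm pos]) (simp_all only: rev E ball_triv simp_thms)
qed

text \<open>The classes belong, in this order, to the angles \<open>a0\<close>, \<open>- a0\<close>,
  \<open>a1\<close>, \<open>- a1\<close>. The six equivalences cover all pairs, so they determine
  the number of classes.\<close>

lemma congr_classes_representatives:
  obtains k1 k2 k3 k4 where "congr_classes l \<gamma> (c ` J) = {k1, k2, k3, k4}"
    "k1 = k2 \<longleftrightarrow> sym_fixing (-1) \<or> (sym_reversing 1 \<and> has_symmetry (\<gamma> ` J))"
    "k3 = k4 \<longleftrightarrow> sym_fixing (-1) \<or> (sym_reversing 1 \<and> has_symmetry (\<gamma> ` J))"
    "k1 = k3 \<longleftrightarrow> has_symmetry (\<gamma> ` J) \<or> sym_reversing (-1)"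
    "k2 = k4 \<longleftrightarrow> has_symmetry (\<gamma> ` J) \<or> sym_reversing (-1)"
    "k1 = k4 \<longleftrightarrow> (sym_fixing (-1) \<and> has_symmetry (\<gamma> ` J)) \<or> sym_reversing 1"
    "k2 = k3 \<longleftrightarrow> (sym_fixing (-1) \<and> has_symmetry (\<gamma> ` J)) \<or> sym_reversing 1"
proof -
  define P where "P = P_star l \<gamma> (c ` J)"
  define r where "r = {(F, G). F \<in> P \<and> G \<in> P \<and> germ_congruent l F G}"
  have r: "equiv P r" unfolding r_def by (rule germ_congruent_equiv)
  have cls: "r `` {F} = r `` {G} \<longleftrightarrow> germ_congruent l F G" if "F \<in> P" "G \<in> P" for F G
    using eq_equiv_class_iff[OF r that] that by (simp add: r_def)
  have mem: "(c, a0) \<in> P" "(c, \<lambda>s. - a0 s) \<in> P" "(c, a1) \<in> P" "(c, \<lambda>s. - a1 s) \<in> P"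
    using mem_P_starI by (auto simp: P_def)
  have "P // r = {r `` {(c, a0)}, r `` {(c, \<lambda>s. - a0 s)}, r `` {(c, a1)}, r `` {(c, \<lambda>s. - a1 s)}}"
  proof
    show "P // r \<subseteq> {r `` {(c, a0)}, r `` {(c, \<lambda>s. - a0 s)}, r `` {(c, a1)}, r `` {(c, \<lambda>s. - a1 s)}}"
    proof
      fix X assume "X \<in> P // r"
      then obtain c' \<alpha> where X: "X = r `` {(c', \<alpha>)}" "(c', \<alpha>) \<in> P" by (auto simp: quotient_def)
      obtain \<alpha>' where "\<alpha>' \<in> {a0, a1}"
        "germ_congruent l (c', \<alpha>) (c, \<alpha>') \<or> germ_congruent l (c', \<alpha>) (c, \<lambda>s. - \<alpha>' s)"
        using P_star_reduce[OF X(2)[unfolded P_def]] .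
      then show "X \<in> {r `` {(c, a0)}, r `` {(c, \<lambda>s. - a0 s)}, r `` {(c, a1)}, r `` {(c, \<lambda>s. - a1 s)}}"
        unfolding X(1) using cls[OF X(2)] mem by auto
    qed
  qed (use mem in \<open>auto intro: quotientI\<close>)
  then have "congr_classes l \<gamma> (c ` J) = {r `` {(c, a0)}, r `` {(c, \<lambda>s. - a0 s)}, r `` {(c, a1)}, r `` {(c, \<lambda>s. - a1 s)}}"
    by (simp add: congr_classes_def r_def P_def)
  then show thesis
    by (rule that) (simp_all only: cls mem congruent_representatives)
qed

end

theorem theoremB:
  fixes l :: real and c :: "real \<Rightarrow> real^3" and \<gamma> :: "real \<Rightarrow> real^2"
    and C :: "(real^3) set" and \<Gamma> :: "(real^2) set"
  assumes "l > 0"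
    and "arclen_param l c" and "C = c ` Jint l"
    and "\<forall>s\<in>Jint l. nderiv 2 c (Jint l) s \<noteq> 0"
    and "arclen_param l \<gamma>" and "\<Gamma> = \<gamma> ` Jint l"
    and "P_star l \<gamma> C \<noteq> {}"
  shows "(\<not> has_symmetry C \<and> \<not> has_symmetry \<Gamma> \<longrightarrow>
            finite (congr_classes l \<gamma> C) \<and> card (congr_classes l \<gamma> C) = 4)
       \<and> (has_symmetry C \<or> has_symmetry \<Gamma> \<longrightarrow>
            finite (congr_classes l \<gamma> C) \<and> card (congr_classes l \<gamma> C) \<le> 2)
       \<and> ((finite (congr_classes l \<gamma> C) \<and> card (congr_classes l \<gamma> C) = 1) \<longleftrightarrow>
            (lies_in_plane C \<and> has_nontrivial_symmetry C)
          \<or> (lies_in_plane C \<and> has_symmetry \<Gamma>)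
          \<or> (\<not> lies_in_plane C \<and> has_positive_symmetry C \<and> has_symmetry \<Gamma>))"
proof -
  interpret crease_data l c \<gamma>
    using assms by unfold_locales blast+
  note C = assms(3) and \<Gamma> = assms(6)
  obtain k1 k2 k3 k4 where cl: "congr_classes l \<gamma> C = {k1, k2, k3, k4}"
    and k: "k1 = k2 \<longleftrightarrow> sym_fixing (-1) \<or> (sym_reversing 1 \<and> has_symmetry \<Gamma>)"
    "k3 = k4 \<longleftrightarrow> sym_fixing (-1) \<or> (sym_reversing 1 \<and> has_symmetry \<Gamma>)"
    "k1 = k3 \<longleftrightarrow> has_symmetry \<Gamma> \<or> sym_reversing (-1)"
    "k2 = k4 \<longleftrightarrow> has_symmetry \<Gamma> \<or> sym_reversing (-1)"
    "k1 = k4 \<longleftrightarrow> (sym_fixing (-1) \<and> has_symmetry \<Gamma>) \<or> sym_reversing 1"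
    "k2 = k3 \<longleftrightarrow> (sym_fixing (-1) \<and> has_symmetry \<Gamma>) \<or> sym_reversing 1"
    by (rule congr_classes_representatives[folded C \<Gamma>]) (rule that)
  \<comment> \<open>A planar arc has reversing symmetries of both orientations or of
    neither.\<close>
  have comp: "sym_reversing 1 \<longleftrightarrow> sym_reversing (-1)" if "sym_fixing (-1)"
    using sym_reversing_minus[OF that, of 1] sym_reversing_minus[OF that, of "-1"] by auto
  have sym: "has_symmetry C \<longleftrightarrow> sym_fixing (-1) \<or> sym_reversing 1 \<or> sym_reversing (-1)"
    "lies_in_plane C \<longleftrightarrow> sym_fixing (-1)"
    "has_nontrivial_symmetry C \<longleftrightarrow> sym_reversing 1 \<or> sym_reversing (-1)"
    "has_positive_symmetry C \<longleftrightarrow> sym_reversing 1"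
    unfolding C using has_symmetry_iff sym_fixing_minus_1_iff has_nontrivial_symmetry_iff has_positive_symmetry_iff
    by blast+
  have fin: "finite (congr_classes l \<gamma> C)" by (simp add: cl)
  have "card (congr_classes l \<gamma> C) = 4" if "\<not> has_symmetry C \<and> \<not> has_symmetry \<Gamma>"
    using that k unfolding cl sym by simp
  moreover have "card (congr_classes l \<gamma> C) \<le> 2" if "has_symmetry C \<or> has_symmetry \<Gamma>"
  proof -
    \<comment> \<open>Each source of symmetry identifies the four classes in pairs: planarity joins
      opposite signs of the same angle, a positive reversal joins \<open>a0\<close> with
      \<open>- a1\<close>, and a negative reversal or a symmetric crease joins \<open>a0\<close>
      with \<open>a1\<close>.\<close>
    have "(k1 = k2 \<and> k3 = k4) \<or> (k1 = k3 \<and> k2 = k4) \<or> (k1 = k4 \<and> k2 = k3)"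
      using that k unfolding sym by blast
    then obtain x y where "{k1, k2, k3, k4} = {x, y}" by blast
    then show ?thesis unfolding cl by (simp add: card_insert_if)
  qed
  moreover have "card (congr_classes l \<gamma> C) = 1 \<longleftrightarrow> k1 = k2 \<and> k1 = k3 \<and> k1 = k4"
    unfolding cl One_nat_def card_1_singleton_iff by blast
  \<comment> \<open>For planar \<open>C\<close> the equality \<open>k1 = k2\<close> is automatic,
    and by \<open>comp\<close> the other two hold together, through a reversal or a symmetric
    crease. For nonplanar \<open>C\<close> the equality \<open>k1 = k2\<close> already demands a
    positive reversal and a symmetric crease, which give the rest.\<close>
  moreover have "k1 = k2 \<and> k1 = k3 \<and> k1 = k4 \<longleftrightarrow>
      (lies_in_plane C \<and> has_nontrivial_symmetry C) \<or> (lies_in_plane C \<and> has_symmetry \<Gamma>)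
      \<or> (\<not> lies_in_plane C \<and> has_positive_symmetry C \<and> has_symmetry \<Gamma>)"
    using comp unfolding k sym by blast
  ultimately show ?thesis using fin by simp
qed

end
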